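(* Let $n\ge 1$ and let $\mathcal R=\{1,3,\dots,m\}$, where $m$ is an odd integer with $1\le m\le 2n-1$. For all $\pi\in\Pi_{\Gamma_{2n-1}^{m}}$, $(-1)^{|\pi|}\mu(\hat 0,\pi)$ equals the number of $\mathcal R$-DID forests on $[2n-1]$ whose trees have node sets equal to the blocks of $\pi$. Consequently, $-\mu_{\Pi_{\Gamma_{2n-1}^{m}}}(\hat 0,\hat 1)$ is equal to the number of $\mathcal R$-DID trees on $[2n-1]$, and $$\chi_{\Pi_{\Gamma_{2n-1}^{m}}}(t)=\sum_{k=1}^{2n-1}(-1)^{k}\,|\mathcal F_{2n-1,k}|\,t^{k-1},$$ where $\mathcal F_{2n-1,k}$ is the set of $\mathcal R$-DID forests on $[2n-1]$ with exactly $k$ trees.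
   Context: $[N]=\{1,\dots,N\}$. Graph: $\Gamma_{2n-1}^{m}$ is the graph with vertex set $[2n-1]$ and edge set $\{\{2i-1,2j\}:1\le i\le j\le n-1\}\cup\{\{i,j\}: i,j\in\{1,3,\dots,m\},\ i<j\}$. Bond lattice: for a finite graph $G=(V,E)$, $\Pi_G$ is the poset of set partitions $\pi$ of $V$ such that the induced subgraph of $G$ on each block of $\pi$ is connected, ordered so that $\pi\le\pi'$ iff every block of $\pi$ is contained in a block of $\pi'$. $\hat 0$ is its minimum element (the partition into singletons), $\hat 1$ is its maximum element, $|\pi|$ is the number of blocks of $\pi$, and $\mu=\mu_{\Pi_G}$ is the Möbius function of $\Pi_G$. The characteristic polynomial of a finite ranked poset $P$ of length $\ell$ with minimum element $\hat 0$ is $\chi_P(t)=\sum_{x\in P}\mu_P(\hat 0,x)\,t^{\ell-\operatorname{rk}(x)}$, where $\operatorname{rk}(x)$ is the rank of $x$. $\mathcal R$-DID trees and forests: a tree $T$ whose vertices are positive integers is an $\mathcal R$-deformed increasing-decreasing ($\mathcal R$-DID) tree if, when $T$ is rooted at its smallest vertex, each internal vertex $v$ satisfies: (i) if $v$ is odd and $v\in\mathcal R$, then $v$ is less than all of its descendants, and each child of $v$ is either even or an odd vertex in $\mathcal R$; (ii) if $v$ is odd and $v\notin\mathcal R$, then $v$ is less than all of its descendants and all of its children are even; (iii) if $v$ is even, then $v$ is greater than all of its descendants and all of its children are odd and not in $\mathcal R$. An $\mathcal R$-DID forest is a forest all of whose components are $\mathcal R$-DID trees; it is "on $[2n-1]$"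 if its vertex set is $[2n-1]$.
   Formalization: Signs corrected to (-1)^{|π|+1}, μ(0,1) and (-1)^{k+1} (as printed, n=m=1 gives -1=1). The tree count and χ formula are stated for m=2n-1; for every m, with c=|1̂|: (-1)^{c+1}μ(0,1)=|F_c| and t^{c-1}χ(t) equals the sum, since vertex 2n-1 is isolated if m<2n-1. *)

theory Defs
  imports
    "HOL-Library.Disjoint_Sets"
    "HOL-Computational_Algebra.Polynomial"
begin

section \<open>Finite posets\<close>

text \<open>
  A poset is given by its carrier \<open>P\<close> and its order relation \<open>r\<close>; \<open>(x, y) \<in> r\<close> means
  \<open>x \<le> y\<close>.  The guard in the Moebius function is there for termination only; for the bond lattice
  it is discharged by \<open>finite_bond_lattice\<close> and \<open>partial_order_bond_lattice\<close> below.
\<close>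

function moebius :: "'a set \<Rightarrow> 'a rel \<Rightarrow> 'a \<Rightarrow> 'a \<Rightarrow> int" where
  "moebius P r x y =
    (if finite P \<and> partial_order_on P r \<and> (x, y) \<in> r
     then (if x = y then 1
           else - (\<Sum>z\<in>{z\<in>P. (x, z) \<in> r \<and> (z, y) \<in> r \<and> z \<noteq> y}. moebius P r x z))
     else 0)"
  by pat_completeness auto
termination
proof (relation "measure (\<lambda>(P, r, x, y). card {w\<in>P. (w, y) \<in> r})", goal_cases)
  case 1
  then show ?case by simp
next
  case (2 P r x y z)
  then have fin: "finite P" and po: "partial_order_on P r" and xy: "(x, y) \<in> r"
    and z: "(z, y) \<in> r" "z \<noteq> y"
    by auto
  have tr: "trans r" and an: "antisym r" and rf: "refl_on P r" and sub: "r \<subseteq> P \<times> P"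
    using po by (auto simp: partial_order_on_def preorder_on_def)
  have "{w\<in>P. (w, z) \<in> r} \<subset> {w\<in>P. (w, y) \<in> r}"
  proof
    show "{w\<in>P. (w, z) \<in> r} \<subseteq> {w\<in>P. (w, y) \<in> r}"
      using tr z by (auto dest: transD)
    have "y \<in> P" using xy sub by auto
    moreover have "(y, y) \<in> r" using rf \<open>y \<in> P\<close> by (auto dest: refl_onD)
    moreover have "(y, z) \<notin> r" using an z by (auto dest: antisymD)
    ultimately show "{w\<in>P. (w, z) \<in> r} \<noteq> {w\<in>P. (w, y) \<in> r}" by blast
  qed
  then have "card {w\<in>P. (w, z) \<in> r} < card {w\<in>P. (w, y) \<in> r}"
    using fin by (intro psubset_card_mono) auto
  then show ?case by simp
qed

declare moebius.simps [simp del]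

definition least_elem :: "'a set \<Rightarrow> 'a rel \<Rightarrow> 'a" where
  "least_elem P r = (THE x. x \<in> P \<and> (\<forall>y\<in>P. (x, y) \<in> r))"

definition greatest_elem :: "'a set \<Rightarrow> 'a rel \<Rightarrow> 'a" where
  "greatest_elem P r = (THE x. x \<in> P \<and> (\<forall>y\<in>P. (y, x) \<in> r))"

text \<open>The length of a chain is one less than the number of its elements.\<close>

definition poset_length :: "'a set \<Rightarrow> 'a rel \<Rightarrow> nat" where
  "poset_length P r = Max {card C - 1 | C. C \<in> Chains r \<and> C \<subseteq> P}"

definition poset_rank :: "'a set \<Rightarrow> 'a rel \<Rightarrow> 'a \<Rightarrow> nat" where
  "poset_rank P r x = poset_length {y\<in>P. (y, x) \<in> r} r"

definition char_poly :: "'a set \<Rightarrow> 'a rel \<Rightarrow> int poly" where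
  "char_poly P r =
    (\<Sum>x\<in>P. monom (moebius P r (least_elem P r) x) (poset_length P r - poset_rank P r x))"


section \<open>Graphs\<close>

text \<open>A graph is a pair of a vertex set and a set of edges, an edge being a two-element set.\<close>

type_synonym 'a ugraph = "'a set \<times> 'a set set"

abbreviation verts :: "'a ugraph \<Rightarrow> 'a set" where "verts \<equiv> fst"
abbreviation edges :: "'a ugraph \<Rightarrow> 'a set set" where "edges \<equiv> snd"

definition simple_graph :: "'a ugraph \<Rightarrow> bool" where
  "simple_graph G \<longleftrightarrow> finite (verts G) \<and> (\<forall>e\<in>edges G. e \<subseteq> verts G \<and> card e = 2)"

definition adj :: "'a ugraph \<Rightarrow> 'a \<Rightarrow> 'a \<Rightarrow> bool" where
  "adj G u v \<longleftrightarrow> {u, v} \<in> edges G"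

definition induced :: "'a ugraph \<Rightarrow> 'a set \<Rightarrow> 'a ugraph" where
  "induced G B = (B, {e\<in>edges G. e \<subseteq> B})"

definition is_path :: "'a ugraph \<Rightarrow> 'a list \<Rightarrow> 'a \<Rightarrow> 'a \<Rightarrow> bool" where
  "is_path G p u v \<longleftrightarrow>
    p \<noteq> [] \<and> hd p = u \<and> last p = v \<and> set p \<subseteq> verts G \<and> distinct p \<and> successively (adj G) p"

definition is_cycle :: "'a ugraph \<Rightarrow> 'a list \<Rightarrow> bool" where
  "is_cycle G p \<longleftrightarrow> 3 \<le> length p \<and> is_path G p (hd p) (last p) \<and> adj G (last p) (hd p)"

definition connected_graph :: "'a ugraph \<Rightarrow> bool" where
  "connected_graph G \<longleftrightarrow>
    verts G \<noteq> {} \<and> (\<forall>u\<in>verts G. \<forall>v\<in>verts G. \<exists>p. is_path G p u v)"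

definition components :: "'a ugraph \<Rightarrow> 'a set set" where
  "components G = (\<lambda>u. {v\<in>verts G. \<exists>p. is_path G p u v}) ` verts G"

definition is_forest :: "'a ugraph \<Rightarrow> bool" where
  "is_forest G \<longleftrightarrow> simple_graph G \<and> \<not> (\<exists>p. is_cycle G p)"

definition is_tree :: "'a ugraph \<Rightarrow> bool" where
  "is_tree G \<longleftrightarrow> is_forest G \<and> connected_graph G"


section \<open>Bond lattices\<close>

definition bond_lattice :: "'a ugraph \<Rightarrow> 'a set set set" where
  "bond_lattice G = {\<pi>. partition_on (verts G) \<pi> \<and> (\<forall>B\<in>\<pi>. connected_graph (induced G B))}"

definition bond_order :: "'a ugraph \<Rightarrow> 'a set set rel" where
  "bond_order G =
    {(\<pi>, \<pi>'). \<pi> \<in> bond_lattice G \<and> \<pi>' \<in> bond_lattice G \<and> refines (verts G) \<pi> \<pi>'}"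

lemma finite_bond_lattice:
  assumes "finite (verts G)"
  shows "finite (bond_lattice G)"
proof (rule finite_subset)
  show "bond_lattice G \<subseteq> Pow (Pow (verts G))"
    by (auto simp: bond_lattice_def partition_on_def)
  show "finite (Pow (Pow (verts G)))" using assms by simp
qed

lemma partial_order_bond_lattice: "partial_order_on (bond_lattice G) (bond_order G)"
  unfolding partial_order_on_def preorder_on_def
proof (intro conjI)
  show "bond_order G \<subseteq> bond_lattice G \<times> bond_lattice G"
    by (auto simp: bond_order_def)
  show "refl_on (bond_lattice G) (bond_order G)"
    by (auto simp: refl_on_def bond_order_def bond_lattice_def intro: refines_refl)
  show "trans (bond_order G)"
    by (auto simp: bond_order_def intro!: transI intro: refines_trans)
  show "antisym (bond_order G)"
  proof (rule antisymI)
    fix \<pi> \<pi>' assume "(\<pi>, \<pi>') \<in> bond_order G" "(\<pi>', \<pi>) \<in> bond_order G"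
    then have "refines (verts G) \<pi> \<pi>'" "refines (verts G) \<pi>' \<pi>"
      by (auto simp: bond_order_def)
    then show "\<pi> = \<pi>'" by (rule refines_asym)
  qed
qed

abbreviation bond_moebius :: "'a ugraph \<Rightarrow> 'a set set \<Rightarrow> 'a set set \<Rightarrow> int" where
  "bond_moebius G \<equiv> moebius (bond_lattice G) (bond_order G)"

abbreviation bond_bot :: "'a ugraph \<Rightarrow> 'a set set" where
  "bond_bot G \<equiv> least_elem (bond_lattice G) (bond_order G)"

abbreviation bond_top :: "'a ugraph \<Rightarrow> 'a set set" where
  "bond_top G \<equiv> greatest_elem (bond_lattice G) (bond_order G)"

abbreviation bond_char_poly :: "'a ugraph \<Rightarrow> int poly" where
  "bond_char_poly G \<equiv> char_poly (bond_lattice G) (bond_order G)"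


section \<open>The graph and the deformed increasing-decreasing trees\<close>

definition odds_upto :: "nat \<Rightarrow> nat set" where
  "odds_upto m = {i. odd i \<and> i \<le> m}"

text \<open>
  Vertex \<open>2*n-1\<close> is isolated unless \<open>m = 2*n-1\<close> (or \<open>n = 1\<close>).  For \<open>m < 2*n-1\<close> the graph thus has
  two components, and the greatest element of its bond lattice has two blocks.
\<close>

definition Gamma :: "nat \<Rightarrow> nat \<Rightarrow> nat ugraph" where
  "Gamma n m =
    ({1..2*n-1},
     {{2*i-1, 2*j} | i j. 1 \<le> i \<and> i \<le> j \<and> j \<le> n-1} \<union>
     {{i, j} | i j. i \<in> odds_upto m \<and> j \<in> odds_upto m \<and> i < j})"

definition tree_root :: "nat ugraph \<Rightarrow> nat" where
  "tree_root T = (LEAST v. v \<in> verts T)"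

text \<open>\<open>w\<close> is a (proper) descendant of \<open>v\<close> if the path from the root to \<open>w\<close> passes through \<open>v\<close>.\<close>

definition descendant :: "nat ugraph \<Rightarrow> nat \<Rightarrow> nat \<Rightarrow> bool" where
  "descendant T v w \<longleftrightarrow> w \<noteq> v \<and> (\<exists>p. is_path T p (tree_root T) w \<and> v \<in> set p)"

definition child :: "nat ugraph \<Rightarrow> nat \<Rightarrow> nat \<Rightarrow> bool" where
  "child T v w \<longleftrightarrow> adj T v w \<and> descendant T v w"

definition internal :: "nat ugraph \<Rightarrow> nat \<Rightarrow> bool" where
  "internal T v \<longleftrightarrow> v \<in> verts T \<and> (\<exists>w. child T v w)"

definition did_tree :: "nat set \<Rightarrow> nat ugraph \<Rightarrow> bool" where
  "did_tree R T \<longleftrightarrow>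
    is_tree T \<and> 0 \<notin> verts T \<and>
    (\<forall>v. internal T v \<longrightarrow>
      (odd v \<and> v \<in> R \<longrightarrow>
        (\<forall>w. descendant T v w \<longrightarrow> v < w) \<and>
        (\<forall>w. child T v w \<longrightarrow> even w \<or> (odd w \<and> w \<in> R))) \<and>
      (odd v \<and> v \<notin> R \<longrightarrow>
        (\<forall>w. descendant T v w \<longrightarrow> v < w) \<and> (\<forall>w. child T v w \<longrightarrow> even w)) \<and>
      (even v \<longrightarrow>
        (\<forall>w. descendant T v w \<longrightarrow> w < v) \<and> (\<forall>w. child T v w \<longrightarrow> odd w \<and> w \<notin> R)))"

definition did_forest :: "nat set \<Rightarrow> nat ugraph \<Rightarrow> bool" where
  "did_forest R F \<longleftrightarrow> is_forest F \<and> (\<forall>C\<in>components F. did_tree R (induced F C))"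

definition did_trees_on :: "nat set \<Rightarrow> nat \<Rightarrow> nat ugraph set" where
  "did_trees_on R N = {T. did_tree R T \<and> verts T = {1..N}}"

definition did_forests_on :: "nat set \<Rightarrow> nat \<Rightarrow> nat ugraph set" where
  "did_forests_on R N = {F. did_forest R F \<and> verts F = {1..N}}"

definition did_forests_k :: "nat set \<Rightarrow> nat \<Rightarrow> nat \<Rightarrow> nat ugraph set" where
  "did_forests_k R N k = {F \<in> did_forests_on R N. card (components F) = k}"

end

theory Submission
  imports Defs
begin

text \<open>
  By the defining recursion, the Moebius function of a bond lattice is
  \<open>\<mu>(0, \<pi>) = (\<Sum>E. (-1) ^ |E|)\<close>, summed over the members \<open>E\<close> with components \<open>\<pi>\<close> of a given family of
  forests, provided that \<open>{}\<close> belongs to the family and that each \<open>\<pi> \<noteq> 0\<close> has an edge \<open>e\<close> inside one of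
  its blocks such that toggling \<open>e\<close> preserves membership: the toggling cancels the terms with \<open>E\<close> inside
  \<open>\<pi>\<close> in pairs.  The deformed increasing-decreasing forests form such a family because they are
  characterised by forbidden paths of length two and three, and these cannot be completed by the
  smallest edge of a block.
\<close>

section \<open>Connectivity in finite graphs\<close>

text \<open>Behind the toggled edges stands Whitney's broken circuit theorem for this order of the
  edges: compare the smaller endpoints; if they agree, compare the larger ones, those in
  \<open>R\<close> increasing and before the even ones, which are decreasing. The obstacle is that
  the tree conditions speak of all descendants of a vertex and that a new edge might close a cycle.
  Both difficulties disappear once membership depends on forbidden patterns alone. On a path from
  the least vertex, each new vertex either exceeds all earlier ones or lies between the two
  preceding ones, so comparisons with near ancestors decide about all descendants. And edges without
  the patterns contain no cycle, so only patterns through the new edge have to be examined. Nothing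
  cancels in the final sum: a forest with components \<open>\<pi>\<close> on 2n-1 vertices has
  2n-1-|\<open>\<pi>\<close>| edges, and since 2n-1 is odd, every term has the sign
  \<open>(-1) ^ (card \<pi> + 1)\<close>.\<close>

abbreviation reach :: "'a ugraph \<Rightarrow> 'a \<Rightarrow> 'a \<Rightarrow> bool" where
  "reach G \<equiv> (adj G)\<^sup>*\<^sup>*"

lemma adj_sym: "adj G u v \<Longrightarrow> adj G v u"
  by (simp add: adj_def insert_commute)

lemma reach_sym: "reach G u v \<Longrightarrow> reach G v u"
  by (induction rule: rtranclp_induct) (auto intro: converse_rtranclp_into_rtranclp adj_sym)

lemma simple_graph_adjD:
  assumes "simple_graph G" "adj G u v"
  shows "u \<in> verts G" "v \<in> verts G" "u \<noteq> v"
  using assms unfolding simple_graph_def adj_def by (force simp: card_insert_if)+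

lemma reach_verts:
  assumes "simple_graph G" "reach G u v" "u \<in> verts G"
  shows "v \<in> verts G"
  using assms(2,3) by (induction rule: rtranclp_induct) (auto dest: simple_graph_adjD[OF assms(1)])

lemma is_path_appendD:
  assumes "is_path G (p @ q) u v"
  shows "p \<noteq> [] \<Longrightarrow> is_path G p u (last p)" "q \<noteq> [] \<Longrightarrow> is_path G q (hd q) v"
  using assms by (auto simp: is_path_def successively_append_iff)

lemma is_path_snocI:
  assumes "simple_graph G" "is_path G p u v" "adj G v w" "w \<notin> set p"
  shows "is_path G (p @ [w]) u w"
  using assms simple_graph_adjD[OF assms(1,3)] by (auto simp: is_path_def successively_append_iff)

lemma reach_if_path: "is_path G p u v \<Longrightarrow> reach G u v"
proof (induction p arbitrary: v rule: rev_induct)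
  case Nil
  then show ?case by (simp add: is_path_def)
next
  case (snoc x xs)
  show ?case
  proof (cases "xs = []")
    case True
    then show ?thesis using snoc.prems by (auto simp: is_path_def)
  next
    case False
    have "reach G u (last xs)" using snoc.IH is_path_appendD(1)[OF snoc.prems False] by blast
    moreover have "adj G (last xs) v"
      using snoc.prems False by (auto simp: is_path_def successively_append_iff)
    ultimately show ?thesis by simp
  qed
qed

text \<open>A walk that returns to a vertex of the path built so far is cut at that vertex. From
  here on \<open>reach\<close>, with transitivity and induction for free, can replace the
  repetition-free \<open>is_path\<close>.\<close>

lemma path_if_reach:
  assumes "simple_graph G" "reach G u v" "u \<in> verts G"
  shows "\<exists>p. is_path G p u v"
  using assms(2)
proof (induction rule: rtranclp_induct)
  case base
  have "is_path G [u] u u" using assms(3) by (simp add: is_path_def)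
  then show ?case ..
next
  case (step y z)
  then obtain p where p: "is_path G p u y" by blast
  show ?case
  proof (cases "z \<in> set p")
    case True
    then obtain q r where "p = (q @ [z]) @ r" using split_list by fastforce
    then show ?thesis using is_path_appendD(1)[of G "q @ [z]" r u y] p by auto
  next
    case False
    then show ?thesis using is_path_snocI[OF assms(1) p step(2)] by blast
  qed
qed

section \<open>Components as classes of reachability\<close>

lemma components_eq:
  assumes "simple_graph G"
  shows "components G = (\<lambda>u. {v. reach G u v}) ` verts G"
  unfolding components_def
proof (rule image_cong[OF refl])
  fix u assume u: "u \<in> verts G"
  show "{v \<in> verts G. \<exists>p. is_path G p u v} = {v. reach G u v}"
    using path_if_reach[OF assms _ u] reach_if_path[of G _ u] reach_verts[OF assms _ u] by auto
qed

lemma partition_on_components: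
  assumes "simple_graph G"
  shows "partition_on (verts G) (components G)"
proof (rule partition_onI)
  show "\<Union>(components G) = verts G"
    using reach_verts[OF assms] by (auto simp: components_eq[OF assms])
next
  fix p q assume "p \<in> components G" "q \<in> components G" "p \<noteq> q"
  then obtain u v where uv: "p = {w. reach G u w}" "q = {w. reach G v w}"
    by (auto simp: components_eq[OF assms])
  show "disjnt p q"
  proof (rule ccontr)
    assume "\<not> disjnt p q"
    then obtain w where "reach G u w" "reach G v w" using uv by (auto simp: disjnt_iff)
    then have "reach G u v" "reach G v u" using reach_sym rtranclp_trans by metis+
    then have "p = q" using uv by (auto intro: rtranclp_trans)
    then show False using \<open>p \<noteq> q\<close> by blast
  qed
next
  show "{} \<notin> components G" by (auto simp: components_eq[OF assms])
qed

lemma finite_components: "finite (verts G) \<Longrightarrow> finite (components G)"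
  by (simp add: components_def)

text \<open>Adjacency is compared only on the vertices of \<open>p\<close>, which allows transfer
  into induced subgraphs as well as into graphs with fewer edges.\<close>

lemma is_path_subgraphI:
  assumes "is_path G p u v" "set p \<subseteq> verts H" "\<And>x y. x \<in> set p \<Longrightarrow> y \<in> set p \<Longrightarrow> adj G x y \<Longrightarrow> adj H x y"
  shows "is_path H p u v"
proof -
  have "successively (adj G) p" using assms(1) by (simp add: is_path_def)
  then have "successively (adj H) p" using assms(3) by (rule successively_mono)
  then show ?thesis using assms(1,2) by (simp add: is_path_def)
qed

lemma component_reach:
  assumes "simple_graph G" "C \<in> components G" "x \<in> C" "reach G x y"
  shows "y \<in> C"
proof -
  obtain u where "C = {v. reach G u v}" using assms(2) by (auto simp: components_eq[OF assms(1)])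
  then show ?thesis using assms(3,4) by simp
qed

lemma reach_in_component:
  assumes "simple_graph G" "C \<in> components G" "x \<in> C" "y \<in> C"
  shows "reach G x y"
proof -
  obtain u where "C = {v. reach G u v}" using assms(2) by (auto simp: components_eq[OF assms(1)])
  then have "reach G x u" "reach G u y" using assms(3,4) reach_sym[of G u x] by simp_all
  then show ?thesis by (rule rtranclp_trans)
qed

lemma path_in_component:
  assumes "simple_graph G" "C \<in> components G" "is_path G p u v" "u \<in> C"
  shows "is_path (induced G C) p u v"
proof -
  have "set p \<subseteq> C"
  proof
    fix x assume "x \<in> set p"
    then obtain q r where "p = (q @ [x]) @ r" using split_list by fastforce
    then have "is_path G (q @ [x]) u x" using is_path_appendD(1)[of G "q @ [x]" r u v] assms(3) by auto
    then show "x \<in> C" using component_reach[OF assms(1,2,4)] reach_if_path by metis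
  qed
  then show ?thesis by (intro is_path_subgraphI[OF assms(3)]) (auto simp: induced_def adj_def)
qed

lemma path_if_induced_path:
  assumes "is_path (induced G C) p u v" "C \<subseteq> verts G"
  shows "is_path G p u v" "set p \<subseteq> C"
proof -
  show "set p \<subseteq> C" using assms by (auto simp: is_path_def induced_def)
  then show "is_path G p u v" using assms
    by (intro is_path_subgraphI[OF assms(1)]) (auto simp: induced_def adj_def)
qed

lemma connected_component:
  assumes "simple_graph G" "C \<in> components G"
  shows "connected_graph (induced G C)"
  unfolding connected_graph_def
proof (intro conjI ballI)
  show "verts (induced G C) \<noteq> {}"
    using partition_onD3[OF partition_on_components[OF assms(1)]] assms(2) by (auto simp: induced_def)
next
  fix u v assume "u \<in> verts (induced G C)" "v \<in> verts (induced G C)"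
  then have "u \<in> C" "v \<in> C" by (auto simp: induced_def)
  moreover have "u \<in> verts G"
    using partition_onD1[OF partition_on_components[OF assms(1)]] assms(2) \<open>u \<in> C\<close> by blast
  ultimately show "\<exists>p. is_path (induced G C) p u v"
    using path_in_component[OF assms] path_if_reach[OF assms(1)] reach_in_component[OF assms] by metis
qed

section \<open>Edge sets and the partitions they generate\<close>

lemma simple_graph_subgraph: "simple_graph G \<Longrightarrow> E \<subseteq> edges G \<Longrightarrow> simple_graph (verts G, E)"
  by (auto simp: simple_graph_def)

lemma reach_mono: "reach (V, E) u v \<Longrightarrow> E \<subseteq> E' \<Longrightarrow> reach (V', E') u v"
  by (erule rtranclp_mono[THEN predicate2D, rotated]) (auto simp: adj_def)

text \<open>Blocks sharing a vertex are equal, so a walk whose edges each lie in some block never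
  leaves its first block. Refinement thus becomes a condition on single edges.\<close>

lemma refines_components_iff:
  assumes "simple_graph G" "partition_on (verts G) \<pi>"
  shows "refines (verts G) (components G) \<pi> \<longleftrightarrow> (\<forall>e\<in>edges G. \<exists>B\<in>\<pi>. e \<subseteq> B)"
proof
  assume ref: "refines (verts G) (components G) \<pi>"
  show "\<forall>e\<in>edges G. \<exists>B\<in>\<pi>. e \<subseteq> B"
  proof
    fix e assume e: "e \<in> edges G"
    then obtain u v where uv: "e = {u, v}" using assms(1) by (auto simp: simple_graph_def card_2_iff)
    then have "adj G u v" using e by (simp add: adj_def)
    then have "{w. reach G u w} \<in> components G" "e \<subseteq> {w. reach G u w}"
      using simple_graph_adjD[OF assms(1)] uv by (auto simp: components_eq[OF assms(1)])
    then show "\<exists>B\<in>\<pi>. e \<subseteq> B" using ref unfolding refines_def by (meson order_trans)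
  qed
next
  assume e: "\<forall>e\<in>edges G. \<exists>B\<in>\<pi>. e \<subseteq> B"
  have *: "v \<in> B" if "reach G u v" "u \<in> B" "B \<in> \<pi>" for u v B
    using that
  proof (induction rule: rtranclp_induct)
    case (step y z)
    then obtain B' where B': "B' \<in> \<pi>" "y \<in> B'" "z \<in> B'" using e by (auto simp: adj_def)
    then have "B' = B" using step partition_onD2[OF assms(2)] by (auto simp: disjoint_def)
    then show ?case using B' by simp
  qed
  have "\<exists>Y\<in>\<pi>. X \<subseteq> Y" if "X \<in> components G" for X
  proof -
    obtain u where u: "u \<in> verts G" "X = {v. reach G u v}" using \<open>X \<in> components G\<close> by (auto simp: components_eq[OF assms(1)])
    then obtain B where "B \<in> \<pi>" "u \<in> B" using partition_onD1[OF assms(2)] by auto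
    then show ?thesis using * u by blast
  qed
  then show "refines (verts G) (components G) \<pi>"
    using partition_on_components[OF assms(1)] assms(2) by (simp add: refines_def)
qed

lemma components_in_bond_lattice:
  assumes "simple_graph G" "E \<subseteq> edges G"
  shows "components (verts G, E) \<in> bond_lattice G"
proof -
  let ?H = "(verts G, E)"
  have s: "simple_graph ?H" using simple_graph_subgraph[OF assms] .
  have "connected_graph (induced G C)" if C: "C \<in> components ?H" for C
  proof -
    have "is_path (induced G C) p u v" if "is_path (induced ?H C) p u v" for p u v
      using that assms(2) by (intro is_path_subgraphI[OF that]) (auto simp: is_path_def induced_def adj_def)
    then show ?thesis using connected_component[OF s C] unfolding connected_graph_def
      by (simp add: induced_def) blast
  qed
  then show ?thesis using partition_on_components[OF s] by (simp add: bond_lattice_def)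
qed

text \<open>The flat of the graphic matroid that belongs to \<open>\<pi>\<close>: the largest set of
  edges whose components refine \<open>\<pi>\<close>.\<close>

definition edges_within :: "'a ugraph \<Rightarrow> 'a set set \<Rightarrow> 'a set set" where
  "edges_within G \<pi> = {e\<in>edges G. \<exists>B\<in>\<pi>. e \<subseteq> B}"

text \<open>Connectedness of the blocks enters here: a path inside a block uses only edges inside
  that block, so the block is not split. Hence every member of the bond lattice comes from an edge
  set.\<close>

lemma components_edges_within:
  assumes "simple_graph G" "\<pi> \<in> bond_lattice G"
  shows "components (verts G, edges_within G \<pi>) = \<pi>"
proof -
  let ?H = "(verts G, edges_within G \<pi>)"
  have s: "simple_graph ?H" using simple_graph_subgraph[OF assms(1)] by (auto simp: edges_within_def)
  have part: "partition_on (verts G) \<pi>" using assms(2) by (simp add: bond_lattice_def)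
  have 1: "refines (verts G) (components ?H) \<pi>"
    using refines_components_iff[OF s] part by (auto simp: edges_within_def)
  have "\<exists>Y\<in>components ?H. B \<subseteq> Y" if B: "B \<in> \<pi>" for B
  proof -
    have conn: "connected_graph (induced G B)" using assms(2) B by (simp add: bond_lattice_def)
    then obtain u where u: "u \<in> B" by (auto simp: connected_graph_def induced_def)
    have "reach ?H u v" if v: "v \<in> B" for v
    proof -
      obtain p where p: "is_path (induced G B) p u v"
        using conn u v by (auto simp: connected_graph_def induced_def)
      have "is_path ?H p u v" using B partition_onD1[OF part] p
        by (intro is_path_subgraphI[OF p]) (auto simp: edges_within_def induced_def adj_def is_path_def)
      then show ?thesis by (rule reach_if_path)
    qed
    moreover have "u \<in> verts ?H" using u B partition_onD1[OF part] by auto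
    ultimately show ?thesis unfolding components_eq[OF s] by blast
  qed
  then have "refines (verts G) \<pi> (components ?H)"
    using part partition_on_components[OF s] by (simp add: refines_def)
  then show ?thesis using refines_asym[OF 1] by simp
qed

text \<open>Sending each block of \<open>P\<close> to a block of \<open>Q\<close> containing it is
  onto; if the cardinalities agree it is injective, so no block of \<open>Q\<close> absorbs two
  blocks of \<open>P\<close>. This makes the number of blocks strictly decreasing along
  chains.\<close>

lemma card_refines_le:
  assumes "refines A P Q" "finite P"
  shows "card Q \<le> card P" "card P = card Q \<Longrightarrow> P = Q"
proof -
  from assms(1) obtain f where f: "\<And>X. X \<in> P \<Longrightarrow> f X \<in> Q \<and> X \<subseteq> f X"
    unfolding refines_def by metis
  have pP: "partition_on A P" and pQ: "partition_on A Q" using assms(1) by (auto simp: refines_def)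
  have surj: "Q \<subseteq> f ` P"
  proof
    fix Y assume Y: "Y \<in> Q"
    then obtain y where y: "y \<in> Y" using partition_onD3[OF pQ] by (metis ex_in_conv)
    then have "y \<in> A" using Y partition_onD1[OF pQ] by auto
    then obtain X where X: "X \<in> P" "y \<in> X" using partition_onD1[OF pP] by auto
    have "f X = Y" using f[OF X(1)] X y Y partition_onD2[OF pQ] by (auto simp: disjoint_def)
    then show "Y \<in> f ` P" using X by auto
  qed
  then show "card Q \<le> card P" by (rule surj_card_le[OF assms(2)])
  assume eq: "card P = card Q"
  have fP: "f ` P = Q" using surj f by blast
  then have inj: "inj_on f P" using eq assms(2) by (simp add: eq_card_imp_inj_on)
  have "f X = X" if X: "X \<in> P" for X
  proof
    show "X \<subseteq> f X" using f X by blast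
    show "f X \<subseteq> X"
    proof
      fix y assume y: "y \<in> f X"
      then have "y \<in> A" using f[OF X] partition_onD1[OF pQ] by auto
      then obtain X' where X': "X' \<in> P" "y \<in> X'" using partition_onD1[OF pP] by auto
      then have "f X' = f X" using f[OF X] f[OF X'(1)] y partition_onD2[OF pQ] unfolding disjoint_def by blast
      then have "X' = X" using inj X X' by (auto dest: inj_onD)
      then show "y \<in> X" using X' by simp
    qed
  qed
  then show "P = Q" using fP by auto
qed

section \<open>Inserting an edge, and the number of edges of a forest\<close>

lemma components_insert_reach:
  assumes "simple_graph (V, insert {a, b} E)" "reach (V, E) a b"
  shows "components (V, insert {a, b} E) = components (V, E)"
proof -
  have s: "simple_graph (V, E)" using assms(1) by (auto simp: simple_graph_def)
  have "reach (V, E) u v" if "reach (V, insert {a, b} E) u v" for u v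
    using that
  proof (induction rule: rtranclp_induct)
    case (step y z)
    have "reach (V, E) y z"
      using step(2) assms(2) reach_sym[OF assms(2)] by (auto simp: adj_def doubleton_eq_iff)
    then show ?case using step by simp
  qed simp
  moreover have "reach (V, insert {a, b} E) u v" if "reach (V, E) u v" for u v
    using reach_mono[OF that] by blast
  ultimately have "reach (V, insert {a, b} E) = reach (V, E)" by (intro ext) blast
  then show ?thesis unfolding components_eq[OF assms(1)] components_eq[OF s] by simp
qed

lemma card_components_insert:
  assumes "simple_graph (V, insert {a, b} E)" "\<not> reach (V, E) a b"
  shows "card (components (V, E)) = Suc (card (components (V, insert {a, b} E)))"
proof -
  let ?H = "(V, E)" and ?H' = "(V, insert {a, b} E)"
  have s: "simple_graph ?H" using assms(1) by (auto simp: simple_graph_def)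
  have fin: "finite V" using assms(1) by (auto simp: simple_graph_def)
  have ab: "a \<in> V" "b \<in> V" using simple_graph_adjD[OF assms(1), of a b] by (auto simp: adj_def)
  define A where "A = {v. reach ?H a v}"
  define B where "B = {v. reach ?H b v}"
  have AB: "A \<noteq> B" "A \<in> components ?H" "B \<in> components ?H"
    using assms(2) ab by (auto simp: A_def B_def components_eq[OF s])
  have sym: "reach ?H u v \<longleftrightarrow> reach ?H v u" for u v using reach_sym by metis
  \<comment> \<open>Invariant of walks in the larger graph: one that starts in \<open>A\<close> or
    \<open>B\<close> stays in their union, any other is already a walk in the smaller graph.\<close>
  have cl: "(if u \<in> A \<or> u \<in> B then v \<in> A \<or> v \<in> B else reach ?H u v)"
    if "reach ?H' u v" for u v
    using that
  proof (induction rule: rtranclp_induct)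
    case base then show ?case by auto
  next
    case (step y z)
    show ?case
    proof (cases "{y, z} = {a, b}")
      case True
      then have "y \<in> A \<or> y \<in> B" "z \<in> A \<or> z \<in> B"
        by (auto simp: A_def B_def doubleton_eq_iff)
      moreover have "u \<in> A \<or> u \<in> B" if "reach ?H u y"
        using \<open>y \<in> A \<or> y \<in> B\<close> rtranclp_trans[OF _ reach_sym[OF that]] by (auto simp: A_def B_def)
      ultimately show ?thesis using step.IH by (auto split: if_splits)
    next
      case False
      then have "adj ?H y z" using step(2) by (auto simp: adj_def)
      then have "reach ?H w y \<Longrightarrow> reach ?H w z" for w by simp
      then show ?thesis using step.IH unfolding A_def B_def mem_Collect_eq by presburger
    qed
  qed
  have up: "reach ?H' u v" if "reach ?H u v" for u v using reach_mono[OF that] by blast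
  have abr: "reach ?H' a b" by (rule r_into_rtranclp) (simp add: adj_def)
  have merged: "reach ?H' u v" if "u \<in> A \<or> u \<in> B" "v \<in> A \<or> v \<in> B" for u v
  proof -
    have "reach ?H' a u" "reach ?H' a v"
      using that abr by (auto simp: A_def B_def dest!: up intro: rtranclp_trans)
    then show ?thesis using reach_sym rtranclp_trans by metis
  qed
  have "components ?H' = insert (A \<union> B) (components ?H - {A, B})"
  proof (intro set_eqI iffI)
    fix X assume "X \<in> components ?H'"
    then obtain u where u: "u \<in> V" "X = {v. reach ?H' u v}" by (auto simp: components_eq[OF assms(1)])
    show "X \<in> insert (A \<union> B) (components ?H - {A, B})"
    proof (cases "u \<in> A \<or> u \<in> B")
      case True
      then have "X = A \<union> B" using u cl[of u] merged[of u] by auto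
      then show ?thesis by simp
    next
      case False
      then have "X = {v. reach ?H u v}" using u cl[of u] up by auto
      moreover from this False have "X \<noteq> A" "X \<noteq> B" by auto
      ultimately show ?thesis using u by (auto simp: components_eq[OF s])
    qed
  next
    fix X assume X: "X \<in> insert (A \<union> B) (components ?H - {A, B})"
    show "X \<in> components ?H'"
    proof (cases "X = A \<union> B")
      case True
      have "a \<in> A" by (simp add: A_def)
      then have "X = {v. reach ?H' a v}" using True cl[of a] merged[of a] by auto
      then show ?thesis using ab by (auto simp: components_eq[OF assms(1)])
    next
      case False
      then obtain u where u: "u \<in> V" "X = {v. reach ?H u v}" "X \<noteq> A" "X \<noteq> B"
        using X by (auto simp: components_eq[OF s])
      have "u \<notin> A" "u \<notin> B"
        using u by (auto simp: A_def B_def) (meson reach_sym rtranclp_trans)+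
      then have "X = {v. reach ?H' u v}" using u cl[of u] up by auto
      then show ?thesis using u by (auto simp: components_eq[OF assms(1)])
    qed
  qed
  moreover have "A \<union> B \<notin> components ?H - {A, B}"
  proof
    assume h: "A \<union> B \<in> components ?H - {A, B}"
    have "a \<in> A \<inter> (A \<union> B)" by (simp add: A_def)
    moreover have "A \<union> B \<in> components ?H" "A \<union> B \<noteq> A" using h by auto
    ultimately show False
      using disjointD[OF partition_onD2[OF partition_on_components[OF s]] _ AB(2)] by auto
  qed
  moreover have f: "finite (components ?H)" using finite_components fin by auto
  \<comment> \<open>Two components are removed and one is added; the bound keeps the subtraction of
    2 from truncating.\<close>
  moreover have "card (components ?H) \<ge> 2"
    using card_mono[OF f, of "{A, B}"] AB by simp
  ultimately show ?thesis using AB by (simp add: card_Diff_subset)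
qed

lemma forest_subgraph:
  assumes "is_forest (V, E)" "E' \<subseteq> E"
  shows "is_forest (V, E')"
proof -
  have "is_path (V, E) p u v" if "is_path (V, E') p u v" for p u v
    using that assms(2) by (intro is_path_subgraphI[OF that]) (auto simp: is_path_def adj_def)
  then have "is_cycle (V, E) p" if "is_cycle (V, E') p" for p
    using that assms(2) by (auto simp: is_cycle_def adj_def)
  then show ?thesis using assms by (auto simp: is_forest_def simple_graph_def)
qed

lemma forest_insert_not_reach:
  assumes "is_forest (V, insert {a, b} E)" "{a, b} \<notin> E"
  shows "\<not> reach (V, E) a b"
proof
  assume r: "reach (V, E) a b"
  have s': "simple_graph (V, insert {a, b} E)" using assms(1) by (simp add: is_forest_def)
  then have s: "simple_graph (V, E)" by (auto simp: simple_graph_def)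
  have ab: "a \<in> V" "a \<noteq> b" using simple_graph_adjD[OF s', of a b] by (auto simp: adj_def)
  obtain p where p: "is_path (V, E) p a b" using path_if_reach[OF s r] ab by auto
  \<comment> \<open>A shorter path would give \<open>a = b\<close> or use the edge
    \<open>{a, b}\<close> itself; a path of at least three vertices closes into a cycle with that
    edge.\<close>
  have "3 \<le> length p"
  proof (rule ccontr)
    assume "\<not> 3 \<le> length p"
    then have "length p = 0 \<or> length p = 1 \<or> length p = 2" by linarith
    then show False using p ab assms(2)
      by (auto simp: is_path_def length_Suc_conv numeral_2_eq_2 adj_def)
  qed
  moreover have "is_path (V, insert {a, b} E) p a b"
    by (rule is_path_subgraphI[OF p]) (use p in \<open>auto simp: is_path_def adj_def\<close>)
  ultimately have "is_cycle (V, insert {a, b} E) p"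
    by (auto simp: is_cycle_def is_path_def adj_def insert_commute)
  then show False using assms(1) by (auto simp: is_forest_def)
qed

lemma components_no_edges: "finite V \<Longrightarrow> components (V, {}) = (\<lambda>x. {x}) ` V"
proof -
  assume "finite V"
  then have s: "simple_graph (V, {})" by (simp add: simple_graph_def)
  have "reach (V, {}) u v \<longleftrightarrow> u = v" for u v
    by (auto simp: adj_def elim: converse_rtranclpE)
  then show ?thesis by (simp add: components_eq[OF s])
qed

lemma card_singletons: "card ((\<lambda>x. {x}) ` V) = card V"
  by (simp add: card_image inj_on_def)

text \<open>In a forest each inserted edge joins two components. The equation fixes the parity of
  \<open>card E\<close> by the number of components, and shows that only the empty edge set yields
  the partition into singletons.\<close>

lemma forest_card:
  assumes "is_forest (V, E)"
  shows "card E + card (components (V, E)) = card V"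
proof -
  have fin: "finite V" and "E \<subseteq> Pow V" using assms by (auto simp: is_forest_def simple_graph_def)
  then have "finite E" by (meson finite_Pow_iff finite_subset)
  then show ?thesis using assms
  proof (induction E)
    case empty
    then show ?case using components_no_edges[OF fin] by (simp add: card_singletons)
  next
    case (insert e E)
    have s: "simple_graph (V, insert e E)" using insert.prems by (simp add: is_forest_def)
    then obtain a b where e: "e = {a, b}" by (auto simp: simple_graph_def card_2_iff)
    have "card (components (V, E)) = Suc (card (components (V, insert e E)))"
      using card_components_insert forest_insert_not_reach insert.prems insert.hyps s unfolding e by metis
    moreover have "is_forest (V, E)" using forest_subgraph[OF insert.prems] by blast
    ultimately show ?case using insert by simp
  qed
qed

section \<open>The Moebius function of a bond lattice\<close>

text \<open>The vanishing of the sums over all intervals from \<open>x\<close> to a larger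
  \<open>y\<close> determines a function upwards from its value at \<open>x\<close>; the induction
  follows the termination measure of \<open>moebius\<close>.\<close>

lemma moebius_unique:
  fixes g :: "'a \<Rightarrow> int"
  assumes "finite P" "partial_order_on P r" "g x = 1"
    and sum0: "\<And>y. (x, y) \<in> r \<Longrightarrow> y \<noteq> x \<Longrightarrow> (\<Sum>z\<in>{z\<in>P. (x, z) \<in> r \<and> (z, y) \<in> r}. g z) = 0"
    and "(x, y) \<in> r"
  shows "moebius P r x y = g y"
  using assms(5)
proof (induction "card {w\<in>P. (w, y) \<in> r}" arbitrary: y rule: less_induct)
  case less
  have tr: "trans r" and an: "antisym r" and rf: "refl_on P r" and sub: "r \<subseteq> P \<times> P"
    using assms(2) by (auto simp: partial_order_on_def preorder_on_def)
  show ?case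
  proof (cases "x = y")
    case True
    then show ?thesis using assms less.prems by (subst moebius.simps) simp
  next
    case False
    let ?S = "{z\<in>P. (x, z) \<in> r \<and> (z, y) \<in> r \<and> z \<noteq> y}"
    have y: "y \<in> P" "(y, y) \<in> r" using less.prems sub rf by (auto dest: refl_onD)
    have "moebius P r x z = g z" if z: "z \<in> ?S" for z
    proof (rule less.hyps)
      have "{w\<in>P. (w, z) \<in> r} \<subseteq> {w\<in>P. (w, y) \<in> r}" using tr z by (auto dest: transD)
      moreover have "(y, z) \<notin> r" using an z by (auto dest: antisymD)
      ultimately have "{w\<in>P. (w, z) \<in> r} \<subset> {w\<in>P. (w, y) \<in> r}" using y by blast
      then show "card {w\<in>P. (w, z) \<in> r} < card {w\<in>P. (w, y) \<in> r}"
        using assms(1) by (intro psubset_card_mono) auto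
      show "(x, z) \<in> r" using z by simp
    qed
    then have "moebius P r x y = - sum g ?S"
      using False assms less.prems by (subst moebius.simps) simp
    moreover have "{z\<in>P. (x, z) \<in> r \<and> (z, y) \<in> r} = insert y ?S" using y less.prems by auto
    then have "g y + sum g ?S = 0" using sum0[OF less.prems] False assms(1) by simp
    ultimately show ?thesis by simp
  qed
qed

section \<open>Intervals of the bond lattice as families of edge sets\<close>

lemma bond_orderD:
  assumes "(\<sigma>, \<pi>) \<in> bond_order G"
  shows "\<sigma> \<in> bond_lattice G" "\<pi> \<in> bond_lattice G" "refines (verts G) \<sigma> \<pi>"
  using assms by (auto simp: bond_order_def)

lemma edges_within_subset: "edges_within G \<pi> \<subseteq> edges G"
  by (auto simp: edges_within_def)

text \<open>The Galois connection between edge sets and partitions; it turns a sum over the interval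
  below \<open>\<pi>\<close> into a sum over the edge sets inside \<open>\<pi>\<close>.\<close>

lemma components_bond_order_iff:
  assumes "simple_graph G" "E \<subseteq> edges G" "\<pi> \<in> bond_lattice G"
  shows "(components (verts G, E), \<pi>) \<in> bond_order G \<longleftrightarrow> E \<subseteq> edges_within G \<pi>"
proof -
  have "partition_on (verts G) \<pi>" using assms(3) by (simp add: bond_lattice_def)
  then show ?thesis
    using refines_components_iff[OF simple_graph_subgraph[OF assms(1,2)]]
      components_in_bond_lattice[OF assms(1,2)] assms(2,3)
    by (auto simp: bond_order_def edges_within_def)
qed

lemma components_bond_order_mono:
  assumes "simple_graph G" "E' \<subseteq> edges G" "E \<subseteq> E'"
  shows "(components (verts G, E), components (verts G, E')) \<in> bond_order G"
proof -
  have L: "components (verts G, E') \<in> bond_lattice G" using components_in_bond_lattice[OF assms(1,2)] .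
  have "(components (verts G, E'), components (verts G, E')) \<in> bond_order G"
    using L by (auto simp: bond_order_def bond_lattice_def intro: refines_refl)
  then have "E' \<subseteq> edges_within G (components (verts G, E'))"
    using components_bond_order_iff[OF assms(1,2) L] by simp
  then show ?thesis using components_bond_order_iff[OF assms(1) _ L, of E] assms by auto
qed

lemma least_elem_eqI:
  assumes "antisym r" "x \<in> P" "\<And>y. y \<in> P \<Longrightarrow> (x, y) \<in> r"
  shows "least_elem P r = x"
  unfolding least_elem_def using assms by (intro the_equality) (auto dest: antisymD)

lemma greatest_elem_eqI:
  assumes "antisym r" "x \<in> P" "\<And>y. y \<in> P \<Longrightarrow> (y, x) \<in> r"
  shows "greatest_elem P r = x"
  unfolding greatest_elem_def using assms by (intro the_equality) (auto dest: antisymD)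

lemma antisym_bond_order: "antisym (bond_order G)"
  using partial_order_bond_lattice[of G] unfolding partial_order_on_def by (rule conjunct2)

lemma components_empty_le:
  assumes "simple_graph G" "\<pi> \<in> bond_lattice G"
  shows "(components (verts G, {}), \<pi>) \<in> bond_order G"
  using components_bond_order_iff[OF assms(1) _ assms(2), of "{}"] by simp

lemma bond_bot_eq:
  assumes "simple_graph G"
  shows "bond_bot G = components (verts G, {})"
  using components_in_bond_lattice[OF assms] components_empty_le[OF assms]
  by (intro least_elem_eqI[OF antisym_bond_order]) auto

lemma le_components:
  assumes "simple_graph G" "\<pi> \<in> bond_lattice G"
  shows "(\<pi>, components G) \<in> bond_order G"
  using components_bond_order_mono[OF assms(1) order_refl edges_within_subset[of G \<pi>]]
  by (simp add: components_edges_within[OF assms])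

lemma components_in_bond_lattice_self:
  "simple_graph G \<Longrightarrow> components G \<in> bond_lattice G"
  using components_in_bond_lattice[of G "edges G"] by simp

text \<open>No connectedness is assumed: for a disconnected graph the greatest element has one block
  for each component.\<close>

lemma bond_top_eq:
  assumes "simple_graph G"
  shows "bond_top G = components G"
  using components_in_bond_lattice_self[OF assms] le_components[OF assms]
  by (intro greatest_elem_eqI[OF antisym_bond_order]) auto

lemma sum_toggle:
  assumes "finite S" "\<And>E. E \<in> S \<Longrightarrow> insert e E \<in> S" "\<And>E. insert e E \<in> S \<Longrightarrow> E \<in> S"
    and "\<And>E. E \<in> S \<Longrightarrow> finite E"
  shows "(\<Sum>E\<in>S. (-1) ^ card E) = (0::int)"
proof -
  define S0 where "S0 = {E\<in>S. e \<notin> E}"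
  have fin: "finite S0" using assms(1) by (simp add: S0_def)
  have "S = S0 \<union> insert e ` S0"
  proof
    show "S \<subseteq> S0 \<union> insert e ` S0"
    proof
      fix E assume E: "E \<in> S"
      show "E \<in> S0 \<union> insert e ` S0"
      proof (cases "e \<in> E")
        case True
        then have "E = insert e (E - {e})" by auto
        moreover from this have "E - {e} \<in> S0" using assms(3)[of "E - {e}"] E by (simp add: S0_def)
        ultimately show ?thesis by blast
      next
        case False
        then show ?thesis using E by (simp add: S0_def)
      qed
    qed
    show "S0 \<union> insert e ` S0 \<subseteq> S" using assms(2) by (auto simp: S0_def)
  qed
  moreover have "S0 \<inter> insert e ` S0 = {}" by (auto simp: S0_def)
  moreover have "inj_on (insert e) S0" by (auto simp: inj_on_def S0_def)
  ultimately have "(\<Sum>E\<in>S. (-1) ^ card E) = (\<Sum>E\<in>S0. (-1) ^ card E) + (\<Sum>E\<in>S0. (-1) ^ card (insert e E) :: int)"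
    using fin by (simp add: sum.union_disjoint sum.reindex)
  \<comment> \<open>Finiteness of the members matters, because \<open>card\<close> would not grow on
    an infinite set.\<close>
  also have "(\<Sum>E\<in>S0. (-1) ^ card (insert e E) :: int) = (\<Sum>E\<in>S0. - ((-1) ^ card E))"
    by (intro sum.cong refl) (use assms(4) in \<open>auto simp: S0_def\<close>)
  finally show ?thesis by (simp add: sum_negf)
qed

text \<open>A form of Whitney's theorem in which the edge \<open>e\<close> may be chosen separately
  for each \<open>\<pi>\<close>, so that no linear order of the edges has to be set up and no cycle
  of the graph has to be inspected.\<close>

theorem bond_moebius_toggle:
  assumes G: "simple_graph G" and L: "L \<subseteq> Pow (edges G)" "{} \<in> L"
    and forest: "\<And>E. E \<in> L \<Longrightarrow> is_forest (verts G, E)"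
    and toggle: "\<And>\<pi>. \<pi> \<in> bond_lattice G \<Longrightarrow> \<pi> \<noteq> bond_bot G \<Longrightarrow>
      \<exists>e\<in>edges_within G \<pi>. \<forall>E\<subseteq>edges_within G \<pi>. insert e E \<in> L \<longleftrightarrow> E \<in> L"
    and \<pi>: "\<pi> \<in> bond_lattice G"
  shows "bond_moebius G (bond_bot G) \<pi> = (\<Sum>E | E \<in> L \<and> components (verts G, E) = \<pi>. (-1) ^ card E)"
proof (rule moebius_unique)
  let ?c = "\<lambda>E. components (verts G, E)"
  have finV: "finite (verts G)" using G by (simp add: simple_graph_def)
  have finE: "finite (edges G)"
    using G finV by (intro finite_subset[of "edges G" "Pow (verts G)"]) (auto simp: simple_graph_def)
  have finL: "finite L" using L finE by (meson finite_Pow_iff finite_subset)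
  show finP: "finite (bond_lattice G)" using finite_bond_lattice[OF finV] .
  show "partial_order_on (bond_lattice G) (bond_order G)" by (rule partial_order_bond_lattice)
  show "(bond_bot G, \<pi>) \<in> bond_order G" using components_empty_le[OF G \<pi>] by (simp add: bond_bot_eq[OF G])
  \<comment> \<open>A forest with as many components as vertices has no edges; this gives the
    initial value 1.\<close>
  have "{E. E \<in> L \<and> ?c E = bond_bot G} = {{}}"
  proof -
    have "E = {}" if "E \<in> L" "?c E = ?c {}" for E
    proof -
      have "card E = 0" using forest_card[OF forest[OF that(1)]] forest_card[OF forest[OF L(2)]] that by simp
      moreover have "finite E" using that L finE by (meson Pow_iff finite_subset subsetD)
      ultimately show ?thesis by simp
    qed
    then show ?thesis using L by (auto simp: bond_bot_eq[OF G])
  qed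
  then show "(\<Sum>E | E \<in> L \<and> ?c E = bond_bot G. (-1) ^ card E) = (1::int)" by simp
  fix \<pi> assume le: "(bond_bot G, \<pi>) \<in> bond_order G" and ne: "\<pi> \<noteq> bond_bot G"
  have \<pi>: "\<pi> \<in> bond_lattice G" using bond_orderD[OF le] by simp
  define T where "T = {\<sigma> \<in> bond_lattice G. (bond_bot G, \<sigma>) \<in> bond_order G \<and> (\<sigma>, \<pi>) \<in> bond_order G}"
  define S where "S = {E\<in>L. E \<subseteq> edges_within G \<pi>}"
  have finS: "finite S" using finL by (simp add: S_def)
  \<comment> \<open>The members of \<open>L\<close> inside \<open>\<pi>\<close> are those whose
    components lie in the interval, so grouping \<open>S\<close> by components yields the double
    sum.\<close>
  have S_iff: "E \<in> S \<longleftrightarrow> E \<in> L \<and> ?c E \<in> T" for E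
    using L components_bond_order_iff[OF G _ \<pi>, of E] components_in_bond_lattice[OF G, of E]
      components_empty_le[OF G] by (auto simp: S_def T_def bond_bot_eq[OF G])
  have "(\<Sum>\<sigma>\<in>T. \<Sum>E | E \<in> L \<and> ?c E = \<sigma>. (-1) ^ card E) = (\<Sum>\<sigma>\<in>T. \<Sum>E | E \<in> S \<and> ?c E = \<sigma>. (-1) ^ card E :: int)"
    by (intro sum.cong refl) (auto simp: S_iff)
  also have "\<dots> = (\<Sum>E\<in>S. (-1) ^ card E)"
    using finP finS S_iff by (intro sum.group) (auto simp: T_def)
  also have "\<dots> = 0"
  proof -
    obtain e where e: "e \<in> edges_within G \<pi>" "\<And>E. E \<subseteq> edges_within G \<pi> \<Longrightarrow> insert e E \<in> L \<longleftrightarrow> E \<in> L"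
      using toggle[OF \<pi> ne] by blast
    show ?thesis
      by (rule sum_toggle[OF finS, of e])
        (use e L finE in \<open>auto simp: S_def intro: finite_subset\<close>)
  qed
  finally show "(\<Sum>\<sigma> | \<sigma> \<in> bond_lattice G \<and> (bond_bot G, \<sigma>) \<in> bond_order G \<and> (\<sigma>, \<pi>) \<in> bond_order G.
     \<Sum>E | E \<in> L \<and> ?c E = \<sigma>. (-1) ^ card E) = (0::int)" by (simp add: T_def)
qed

section \<open>Rank, length and characteristic polynomial\<close>

lemma card_bond_lattice_le:
  assumes "simple_graph G" "\<pi> \<in> bond_lattice G"
  shows "card \<pi> \<le> card (verts G)"
proof -
  have fin: "finite (verts G)" using assms by (simp add: simple_graph_def)
  show ?thesis
    using card_refines_le(1)[OF bond_orderD(3)[OF components_empty_le[OF assms]]] fin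
    by (simp add: components_no_edges card_singletons)
qed

lemma card_top_le:
  assumes "simple_graph G" "\<pi> \<in> bond_lattice G"
  shows "card (components G) \<le> card \<pi>"
proof -
  have "finite \<pi>" using assms by (auto simp: simple_graph_def bond_lattice_def intro: finite_elements)
  then show ?thesis using card_refines_le(1)[OF bond_orderD(3)[OF le_components[OF assms]]] by simp
qed

text \<open>Insert the edges one by one: an edge either leaves the components alone or merges two of
  them, and then the coarser partition is put on top of the chain.\<close>

lemma ex_bond_chain:
  assumes "simple_graph G" "finite E" "E \<subseteq> edges G"
  shows "\<exists>C. C \<in> Chains (bond_order G) \<and> finite C \<and> (\<forall>\<sigma>\<in>C. (\<sigma>, components (verts G, E)) \<in> bond_order G) \<and>
    card C + card (components (verts G, E)) = Suc (card (verts G))"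
  using assms(2,3)
proof (induction E)
  case empty
  have "finite (verts G)" using assms(1) by (simp add: simple_graph_def)
  moreover have "(components (verts G, {}), components (verts G, {})) \<in> bond_order G"
    using components_bond_order_mono[OF assms(1), of "{}" "{}"] by simp
  ultimately show ?case
    by (intro exI[of _ "{components (verts G, {})}"])
      (auto simp: Chains_def components_no_edges card_singletons)
next
  case (insert e E)
  let ?c = "\<lambda>E. components (verts G, E)"
  obtain C where C: "C \<in> Chains (bond_order G)" "finite C" "\<And>\<sigma>. \<sigma> \<in> C \<Longrightarrow> (\<sigma>, ?c E) \<in> bond_order G"
    "card C + card (?c E) = Suc (card (verts G))"
    using insert by auto
  have s: "simple_graph (verts G, insert e E)" using simple_graph_subgraph[OF assms(1) insert.prems] .
  then obtain a b where e: "e = {a, b}" by (auto simp: simple_graph_def card_2_iff)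
  show ?case
  proof (cases "reach (verts G, E) a b")
    case True
    then show ?thesis using C components_insert_reach[of "verts G" a b E] s unfolding e by metis
  next
    case False
    let ?n = "?c (insert e E)"
    have card: "card (?c E) = Suc (card ?n)"
      using card_components_insert[of "verts G" a b E] s False unfolding e by blast
    have le: "(?c E, ?n) \<in> bond_order G" using components_bond_order_mono[OF assms(1) insert.prems] by blast
    have refl: "(?n, ?n) \<in> bond_order G" using components_bond_order_mono[OF assms(1) insert.prems] by blast
    have le': "(\<sigma>, ?n) \<in> bond_order G" if "\<sigma> \<in> C" for \<sigma>
      using C(3)[OF that] le partial_order_bond_lattice[of G]
      by (auto simp: partial_order_on_def preorder_on_def dest: transD)
    have "?n \<notin> C"
    proof
      assume "?n \<in> C"
      then have "(?n, ?c E) \<in> bond_order G" using C(3) by blast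
      then have "?n = ?c E" using le antisymD[OF antisym_bond_order] by blast
      then show False using card by simp
    qed
    then show ?thesis using C card le' refl
      by (intro exI[of _ "insert ?n C"]) (auto simp: Chains_def)
  qed
qed

text \<open>Comparable partitions with equally many blocks coincide, so a chain below
  \<open>\<pi>\<close> has at most one element for each number from \<open>card \<pi>\<close> to the
  number of vertices. The chain obtained from the edges within \<open>\<pi>\<close> attains the
  bound.\<close>

lemma poset_rank_bond_lattice:
  assumes "simple_graph G" "\<pi> \<in> bond_lattice G"
  shows "poset_rank (bond_lattice G) (bond_order G) \<pi> = card (verts G) - card \<pi>"
  unfolding poset_rank_def poset_length_def
proof (rule Max_eqI)
  let ?P = "{\<sigma> \<in> bond_lattice G. (\<sigma>, \<pi>) \<in> bond_order G}"
  have finV: "finite (verts G)" using assms(1) by (simp add: simple_graph_def)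
  have finP: "finite ?P" using finite_bond_lattice[OF finV] by simp
  have "{card C - 1 | C. C \<in> Chains (bond_order G) \<and> C \<subseteq> ?P} \<subseteq> (\<lambda>C. card C - 1) ` Pow ?P"
    by blast
  then show "finite {card C - 1 | C. C \<in> Chains (bond_order G) \<and> C \<subseteq> ?P}"
    using finP by (meson finite_Pow_iff finite_imageI finite_subset)
  show "k \<le> card (verts G) - card \<pi>"
    if k: "k \<in> {card C - 1 | C. C \<in> Chains (bond_order G) \<and> C \<subseteq> ?P}" for k
  proof -
    from k obtain C where C: "C \<in> Chains (bond_order G)" "C \<subseteq> ?P" "k = card C - 1" by blast
    have fin: "finite \<sigma>" if "\<sigma> \<in> bond_lattice G" for \<sigma>
      using that finV by (auto simp: bond_lattice_def intro: finite_elements)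
    have "inj_on card C"
    proof (rule inj_onI)
      fix \<sigma> \<tau> assume st: "\<sigma> \<in> C" "\<tau> \<in> C" "card \<sigma> = card \<tau>"
      then consider "(\<sigma>, \<tau>) \<in> bond_order G" | "(\<tau>, \<sigma>) \<in> bond_order G" using C(1) by (auto simp: Chains_def)
      then show "\<sigma> = \<tau>"
      proof cases
        case 1
        then show ?thesis
          using card_refines_le(2)[OF bond_orderD(3)[OF 1] fin[OF bond_orderD(1)[OF 1]]] st(3) by simp
      next
        case 2
        then show ?thesis
          using card_refines_le(2)[OF bond_orderD(3)[OF 2] fin[OF bond_orderD(1)[OF 2]]] st(3) by simp
      qed
    qed
    moreover have "card ` C \<subseteq> {card \<pi>..card (verts G)}"
    proof
      fix k assume "k \<in> card ` C"
      then obtain \<sigma> where s: "\<sigma> \<in> ?P" "k = card \<sigma>" using C(2) by blast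
      then show "k \<in> {card \<pi>..card (verts G)}"
        using card_refines_le(1)[OF bond_orderD(3), of \<sigma> \<pi> G] fin card_bond_lattice_le[OF assms(1)] by auto
    qed
    ultimately have "card C \<le> card {card \<pi>..card (verts G)}" by (intro card_inj_on_le) auto
    then show ?thesis using C(3) by simp
  qed
  have "edges G \<subseteq> Pow (verts G)" using assms(1) by (auto simp: simple_graph_def)
  then have "finite (edges_within G \<pi>)"
    using finV edges_within_subset[of G \<pi>] by (meson finite_Pow_iff finite_subset)
  then obtain C where C: "C \<in> Chains (bond_order G)" "\<forall>\<sigma>\<in>C. (\<sigma>, \<pi>) \<in> bond_order G"
    "card C + card \<pi> = Suc (card (verts G))"
    using ex_bond_chain[OF assms(1) _ edges_within_subset[of G \<pi>]] components_edges_within[OF assms] by auto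
  then have "C \<subseteq> ?P" using bond_orderD by blast
  moreover have "card (verts G) - card \<pi> = card C - 1" using C(3) by simp
  ultimately show "card (verts G) - card \<pi> \<in> {card C - 1 | C. C \<in> Chains (bond_order G) \<and> C \<subseteq> ?P}"
    using C(1) by blast
qed

lemma poset_length_bond_lattice:
  assumes "simple_graph G"
  shows "poset_length (bond_lattice G) (bond_order G) = card (verts G) - card (components G)"
proof -
  have "{\<sigma> \<in> bond_lattice G. (\<sigma>, components G) \<in> bond_order G} = bond_lattice G"
    using le_components[OF assms] by blast
  then show ?thesis
    using poset_rank_bond_lattice[OF assms components_in_bond_lattice_self[OF assms]]
    by (simp add: poset_rank_def)
qed

text \<open>Length minus rank is \<open>card \<pi>\<close> minus the number of components. The extra
  power of t shifts this exponent to \<open>card \<pi> - 1\<close>, whether or not the graph is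
  connected.\<close>

lemma monom_times_bond_char_poly:
  assumes "simple_graph G" "verts G \<noteq> {}"
  shows "monom 1 (card (components G) - 1) * bond_char_poly G =
    (\<Sum>\<pi>\<in>bond_lattice G. monom (bond_moebius G (bond_bot G) \<pi>) (card \<pi> - 1))"
  unfolding char_poly_def sum_distrib_left
proof (intro sum.cong refl)
  fix \<pi> assume \<pi>: "\<pi> \<in> bond_lattice G"
  have "finite (verts G)" using assms(1) by (simp add: simple_graph_def)
  then have "card (components G) > 0" using assms(2) by (simp add: components_def card_gt_0_iff)
  \<comment> \<open>All these subtractions are on naturals; they are exact because 1 \<le>
    \<open>card (components G)\<close> \<le> \<open>card \<pi>\<close> \<le>
    \<open>card (verts G)\<close>.\<close>
  then have "card (components G) - 1 + (card (verts G) - card (components G) - (card (verts G) - card \<pi>)) = card \<pi> - 1"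
    using card_top_le[OF assms(1) \<pi>] card_bond_lattice_le[OF assms(1) \<pi>] by linarith
  then show "monom 1 (card (components G) - 1) *
      monom (bond_moebius G (bond_bot G) \<pi>)
        (poset_length (bond_lattice G) (bond_order G) - poset_rank (bond_lattice G) (bond_order G) \<pi>) =
      monom (bond_moebius G (bond_bot G) \<pi>) (card \<pi> - 1)"
    by (simp add: mult_monom poset_length_bond_lattice[OF assms(1)] poset_rank_bond_lattice[OF assms(1) \<pi>])
qed

section \<open>Deformed increasing-decreasing forests by forbidden patterns\<close>

definition desc_ok :: "nat \<Rightarrow> nat \<Rightarrow> bool" where
  "desc_ok v w \<longleftrightarrow> (if odd v then v < w else w < v)"

definition child_ok :: "nat set \<Rightarrow> nat \<Rightarrow> nat \<Rightarrow> bool" where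
  "child_ok R v w \<longleftrightarrow> (if even v then odd w \<and> w \<notin> R else odd w \<longrightarrow> v \<in> R \<and> w \<in> R)"

text \<open>Meant for paths from the root: \<open>sorted_wrt\<close> compares every ancestor with
  every descendant, \<open>successively\<close> only parents with children.\<close>

definition did_path :: "nat set \<Rightarrow> nat list \<Rightarrow> bool" where
  "did_path R p \<longleftrightarrow> sorted_wrt desc_ok p \<and> successively (child_ok R) p"

lemma did_path_snoc:
  "did_path R (p @ [w]) \<longleftrightarrow>
    did_path R p \<and> (\<forall>v\<in>set p. desc_ok v w) \<and> (p \<noteq> [] \<longrightarrow> child_ok R (last p) w)"
  by (auto simp: did_path_def sorted_wrt_append successively_append_iff)

section \<open>Paths from the root of a tree\<close>

lemma is_path_split_inner:
  assumes "is_path G p u w" "v \<in> set p" "v \<noteq> w"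
  obtains q c r where "p = q @ v # c # r"
proof -
  obtain q r where p: "p = q @ v # r" using assms(2) split_list by fastforce
  then have "r \<noteq> []" using assms(1,3) by (auto simp: is_path_def)
  then show ?thesis using p that by (cases r) auto
qed

text \<open>If the path went from \<open>v\<close> to its neighbour \<open>w\<close> by a detour,
  the edge between them would close a cycle.\<close>

lemma forest_path_step_last:
  assumes "is_forest G" "is_path G (q @ v # r) u w" "adj G v w"
  shows "r = [w]"
proof -
  have suffix: "is_path G (v # r) v w" using is_path_appendD(2)[OF assms(2)] by simp
  have "v \<noteq> w" using assms(1,3) simple_graph_adjD(3)[of G v w] by (simp add: is_forest_def)
  then have r: "r \<noteq> []" "last r = w" using suffix by (auto simp: is_path_def)
  show ?thesis
  proof (rule ccontr)
    assume "r \<noteq> [w]"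
    then have "length r \<ge> 2" using r by (cases r rule: remdups_adj.cases) auto
    then have "is_cycle G (v # r)"
      using suffix r adj_sym[OF assms(3)] by (auto simp: is_cycle_def)
    then show False using assms(1) by (auto simp: is_forest_def)
  qed
qed

lemma forest_path_snoc:
  assumes "is_forest G" "is_path G p u v" "adj G v w" "\<nexists>q. p = q @ [w, v]"
  shows "is_path G (p @ [w]) u w"
proof (rule is_path_snocI[OF _ assms(2,3)])
  show "simple_graph G" using assms(1) by (simp add: is_forest_def)
  show "w \<notin> set p"
  proof
    assume "w \<in> set p"
    then obtain q r where p: "p = q @ w # r" using split_list by fastforce
    then have "r = [v]" using forest_path_step_last[of G q w r u v] assms(1,2) adj_sym[OF assms(3)] by simp
    then show False using assms(4) p by simp
  qed
qed

text \<open>Every pair of a vertex and its descendant occurs on a path from the root, and in a tree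
  a child is the immediate successor of its parent there. The restriction to internal vertices is
  harmless, since a vertex with a descendant has a child.\<close>

lemma did_tree_iff:
  "did_tree R T \<longleftrightarrow> is_tree T \<and> 0 \<notin> verts T \<and> (\<forall>p w. is_path T p (tree_root T) w \<longrightarrow> did_path R p)"
proof (intro iffI conjI allI impI)
  assume did: "did_tree R T"
  show "is_tree T" "0 \<notin> verts T" using did by (simp_all add: did_tree_def)
  have internal: "internal T v" if "descendant T v w" for v w
  proof -
    obtain p where p: "is_path T p (tree_root T) w" "v \<in> set p" "v \<noteq> w"
      using \<open>descendant T v w\<close> by (auto simp: descendant_def)
    then obtain q c r where "p = q @ v # c # r" using is_path_split_inner by metis
    then have pr: "is_path T ((q @ [v, c]) @ r) (tree_root T) w" using p by simp
    then have "is_path T (q @ [v, c]) (tree_root T) c" using is_path_appendD(1)[OF pr] by simp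
    then have "child T v c"
      unfolding child_def descendant_def
      by (intro conjI exI[of _ "q @ [v, c]"]) (auto simp: is_path_def successively_append_iff)
    moreover have "v \<in> verts T" using p by (auto simp: is_path_def)
    ultimately show ?thesis by (auto simp: internal_def)
  qed
  have desc: "desc_ok v w" if "descendant T v w" for v w
  proof -
    have "(odd v \<longrightarrow> v < w) \<and> (even v \<longrightarrow> w < v)"
      using did internal[OF that] that unfolding did_tree_def by metis
    then show ?thesis by (simp add: desc_ok_def)
  qed
  have child: "child_ok R v w" if "child T v w" for v w
  proof -
    have "internal T v" using internal that by (auto simp: child_def)
    then have "(odd v \<longrightarrow> even w \<or> v \<in> R \<and> w \<in> R) \<and> (even v \<longrightarrow> odd w \<and> w \<notin> R)"
      using did that unfolding did_tree_def by metis
    then show ?thesis by (auto simp: child_ok_def)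
  qed
  fix p w assume "is_path T p (tree_root T) w"
  then show "did_path R p"
  proof (induction p arbitrary: w rule: rev_induct)
    case Nil
    then show ?case by (simp add: is_path_def)
  next
    case (snoc x p)
    have "x = w" using snoc.prems by (simp add: is_path_def)
    have "did_path R p"
    proof (cases "p = []")
      case False
      then show ?thesis using snoc.IH is_path_appendD(1)[OF snoc.prems] by blast
    qed (simp add: did_path_def)
    moreover have d: "descendant T v x" if "v \<in> set p" for v
      unfolding descendant_def using snoc.prems that \<open>x = w\<close>
      by (intro conjI exI[of _ "p @ [x]"]) (auto simp: is_path_def)
    moreover have "child T (last p) x" if "p \<noteq> []"
      using d[OF last_in_set[OF that]] that snoc.prems by (auto simp: child_def is_path_def successively_append_iff)
    ultimately show ?case using desc child by (auto simp: did_path_snoc)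
  qed
next
  assume asm: "is_tree T \<and> 0 \<notin> verts T \<and> (\<forall>p w. is_path T p (tree_root T) w \<longrightarrow> did_path R p)"
  then have forest: "is_forest T" by (simp add: is_tree_def)
  have desc: "desc_ok v w" if "descendant T v w" for v w
  proof -
    obtain p where p: "is_path T p (tree_root T) w" "v \<in> set p" "v \<noteq> w"
      using \<open>descendant T v w\<close> by (auto simp: descendant_def)
    then obtain q where "p = q @ [w]" by (metis append_butlast_last_id is_path_def)
    then show ?thesis using p asm did_path_snoc[of R q w] by auto
  qed
  have child: "child_ok R v w" if "child T v w" for v w
  proof -
    obtain p where p: "is_path T p (tree_root T) w" "v \<in> set p" and adj: "adj T v w"
      using \<open>child T v w\<close> by (auto simp: child_def descendant_def)
    then obtain q r where pq: "p = q @ v # r" using split_list by fastforce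
    then have "r = [w]" using forest_path_step_last[OF forest _ adj] p by blast
    then show ?thesis using asm p pq did_path_snoc[of R "q @ [v]" w] by auto
  qed
  have "odd v \<Longrightarrow> v < w" "even v \<Longrightarrow> w < v" if "descendant T v w" for v w
    using desc[OF that] by (simp_all add: desc_ok_def)
  moreover have "odd v \<Longrightarrow> even w \<or> v \<in> R \<and> odd w \<and> w \<in> R" "even v \<Longrightarrow> odd w \<and> w \<notin> R"
    if "child T v w" for v w
    using child[OF that] by (auto simp: child_ok_def)
  ultimately show "did_tree R T" unfolding did_tree_def using asm by blast
qed

lemma tree_root_induced:
  assumes "x \<in> C" "\<And>y. y \<in> C \<Longrightarrow> x \<le> y"
  shows "tree_root (induced G C) = x"
  unfolding tree_root_def induced_def using assms by (intro Least_equality) auto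

text \<open>The roots of the trees are the vertices minimal among those reachable from them. In this
  form components and induced subgraphs no longer occur in the condition.\<close>

lemma did_forest_iff:
  "did_forest R F \<longleftrightarrow> is_forest F \<and> 0 \<notin> verts F \<and>
    (\<forall>p u v. is_path F p u v \<longrightarrow> (\<forall>w. reach F u w \<longrightarrow> u \<le> w) \<longrightarrow> did_path R p)"
proof (intro iffI conjI allI impI)
  assume did: "did_forest R F"
  then show forest: "is_forest F" by (simp add: did_forest_def)
  then have s: "simple_graph F" by (simp add: is_forest_def)
  have tree: "did_tree R (induced F C)" if "C \<in> components F" for C
    using did that by (simp add: did_forest_def)
  show "0 \<notin> verts F"
  proof
    assume "0 \<in> verts F"
    then have "{v. reach F 0 v} \<in> components F" by (auto simp: components_eq[OF s])
    from tree[OF this] show False by (simp add: did_tree_def induced_def)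
  qed
  fix p u v assume p: "is_path F p u v" and min: "\<forall>w. reach F u w \<longrightarrow> u \<le> w"
  define C where "C = {v. reach F u v}"
  have "u \<in> verts F" using p by (auto simp: is_path_def)
  then have C: "C \<in> components F" by (auto simp: components_eq[OF s] C_def)
  have "tree_root (induced F C) = u" using min by (intro tree_root_induced) (auto simp: C_def)
  moreover have "is_path (induced F C) p u v" using path_in_component[OF s C p] by (simp add: C_def)
  ultimately show "did_path R p" using tree[OF C] unfolding did_tree_iff by metis
next
  assume asm: "is_forest F \<and> 0 \<notin> verts F \<and>
    (\<forall>p u v. is_path F p u v \<longrightarrow> (\<forall>w. reach F u w \<longrightarrow> u \<le> w) \<longrightarrow> did_path R p)"
  then have s: "simple_graph F" by (simp add: is_forest_def)
  have "did_tree R (induced F C)" if C: "C \<in> components F" for C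
  proof -
    have sub: "C \<subseteq> verts F" using partition_onD1[OF partition_on_components[OF s]] C by blast
    have "simple_graph (induced F C)"
      using s sub by (auto simp: simple_graph_def induced_def intro: finite_subset)
    moreover have "is_cycle F p" if "is_cycle (induced F C) p" for p
      using that path_if_induced_path[OF _ sub] by (auto simp: is_cycle_def adj_def induced_def)
    ultimately have "is_forest (induced F C)" using asm by (auto simp: is_forest_def)
    then have "is_tree (induced F C)" using connected_component[OF s C] by (simp add: is_tree_def)
    moreover have "0 \<notin> verts (induced F C)" using asm sub by (auto simp: induced_def)
    moreover have "did_path R p" if p: "is_path (induced F C) p (tree_root (induced F C)) w" for p w
    proof -
      let ?r = "tree_root (induced F C)"
      have "?r \<in> set p" using p hd_in_set[of p] unfolding is_path_def by metis
      then have r: "?r \<in> C" using p by (auto simp: is_path_def induced_def)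
      have "?r \<le> y" if "y \<in> C" for y
        using that by (auto simp: tree_root_def induced_def intro: Least_le)
      then have "?r \<le> y" if "reach F ?r y" for y using component_reach[OF s C r that] by blast
      then show ?thesis using path_if_induced_path(1)[OF p sub] asm by blast
    qed
    ultimately show ?thesis unfolding did_tree_iff by blast
  qed
  then show "did_forest R F" using asm by (simp add: did_forest_def)
qed

text \<open>
  The last two conditions forbid the minimal broken circuits: a triangle or a 4-cycle without its
  smallest edge.
\<close>

definition nbc_edges :: "nat set \<Rightarrow> nat set set \<Rightarrow> bool" where
  "nbc_edges R E \<longleftrightarrow>
    (\<forall>u v. {u, v} \<in> E \<and> u < v \<longrightarrow> odd u \<and> (even v \<or> u \<in> R \<and> v \<in> R)) \<and>
    (\<forall>u v w. {u, v} \<in> E \<and> {v, w} \<in> E \<and> u \<noteq> w \<and> u \<in> R \<and> w \<in> R \<longrightarrow> \<not> (u < v \<and> w < v)) \<and>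
    (\<forall>a b c d. {a, b} \<in> E \<and> {b, c} \<in> E \<and> {c, d} \<in> E \<and> odd a \<and> even b \<and> odd c \<and> even d \<and> a < c
      \<longrightarrow> \<not> b < d)"

section \<open>From deformed increasing-decreasing forests to forbidden patterns\<close>

lemma nbc_edgesI:
  assumes "\<And>u v. {u, v} \<in> E \<Longrightarrow> u < v \<Longrightarrow> odd u \<and> (even v \<or> u \<in> R \<and> v \<in> R)"
    and "\<And>u v w. {u, v} \<in> E \<Longrightarrow> {v, w} \<in> E \<Longrightarrow> u \<noteq> w \<Longrightarrow> u \<in> R \<Longrightarrow> w \<in> R \<Longrightarrow> u < v \<Longrightarrow> w < v \<Longrightarrow> False"
    and "\<And>a b c d. {a, b} \<in> E \<Longrightarrow> {b, c} \<in> E \<Longrightarrow> {c, d} \<in> E \<Longrightarrow>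
      odd a \<Longrightarrow> even b \<Longrightarrow> odd c \<Longrightarrow> even d \<Longrightarrow> a < c \<Longrightarrow> b < d \<Longrightarrow> False"
  shows "nbc_edges R E"
  using assms unfolding nbc_edges_def by blast

text \<open>A root path ending in an inner vertex of a pattern has at most one neighbour of that
  vertex as predecessor. It can be extended along the remaining edges of the pattern, and the
  extension violates \<open>did_path\<close>.\<close>

lemma nbc_edges_if_did_forest:
  assumes did: "did_forest R (V, E)" and R: "\<And>v. v \<in> R \<Longrightarrow> odd v"
  shows "nbc_edges R E"
proof -
  let ?F = "(V, E)"
  have forest: "is_forest ?F"
    and good: "\<And>p u v. is_path ?F p u v \<Longrightarrow> (\<And>w. reach ?F u w \<Longrightarrow> u \<le> w) \<Longrightarrow> did_path R p"
    using did unfolding did_forest_iff by blast+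
  have s: "simple_graph ?F" using forest by (simp add: is_forest_def)
  have path: "\<exists>p u. is_path ?F p u v \<and> (\<forall>w. reach ?F u w \<longrightarrow> u \<le> w)" if v: "v \<in> V" for v
  proof -
    define u where "u = (LEAST u. reach ?F v u)"
    have u: "reach ?F v u" unfolding u_def by (rule LeastI[of _ v]) simp
    have "u \<le> w" if "reach ?F u w" for w
      using Least_le[of "reach ?F v" w] rtranclp_trans[OF u that] by (simp add: u_def)
    moreover have "u \<in> V" using reach_verts[OF s u] v by simp
    ultimately show ?thesis using path_if_reach[OF s reach_sym[OF u]] by auto
  qed
  \<comment> \<open>Each edge is the last step of some root path, in one direction or the
    other.\<close>
  have edge_path: "\<exists>p u. (\<forall>w. reach ?F u w \<longrightarrow> u \<le> w) \<and>
      (is_path ?F p u v \<and> (\<exists>q. p = q @ [w, v]) \<or> is_path ?F p u w \<and> (\<exists>q. p = q @ [v, w] \<and> is_path ?F (q @ [v]) u v))"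
    if vw: "adj ?F v w" for v w
  proof -
    obtain p u where p: "is_path ?F p u v" "\<forall>w. reach ?F u w \<longrightarrow> u \<le> w"
      using path[of v] simple_graph_adjD(1)[OF s vw] by (simp, blast)
    show ?thesis
    proof (cases "\<exists>q. p = q @ [w, v]")
      case True then show ?thesis using p by blast
    next
      case False
      have p': "is_path ?F (p @ [w]) u w" using forest_path_snoc[OF forest p(1) vw False] .
      obtain q where q: "p = q @ [v]"
        using p(1) by (metis append_butlast_last_id is_path_def)
      then show ?thesis using p p' by (intro exI[of _ "p @ [w]"] exI[of _ u]) auto
    qed
  qed
  have edge: "desc_ok v w \<and> child_ok R v w \<or> desc_ok w v \<and> child_ok R w v" if "adj ?F v w" for v w
  proof -
    from edge_path[OF that] obtain q where "did_path R (q @ [v, w]) \<or> did_path R (q @ [w, v])"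
      using good by blast
    then show ?thesis by (auto simp: did_path_def sorted_wrt_append successively_append_iff)
  qed
  have "odd u \<and> (even v \<or> u \<in> R \<and> v \<in> R)" if "{u, v} \<in> E" "u < v" for u v
    using edge[of u v] that R by (auto simp: adj_def desc_ok_def child_ok_def split: if_splits)
  moreover have False
    if uv: "{u, v} \<in> E" "{v, w} \<in> E" "u \<noteq> w" "u \<in> R" "w \<in> R" "u < v" "w < v" for u v w
  proof -
    have adj: "adj ?F v u" "adj ?F v w" using uv by (auto simp: adj_def insert_commute)
    have "v \<in> V" using simple_graph_adjD(1)[OF s adj(1)] by simp
    then obtain p r where p: "is_path ?F p r v" "\<forall>w. reach ?F r w \<longrightarrow> r \<le> w"
      using path by blast
    \<comment> \<open>A child \<open>x\<close> of \<open>v\<close> with \<open>x < v\<close> forces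
      \<open>v\<close> to be even, and an even vertex has no child in \<open>R\<close>. So both
      \<open>u\<close> and \<open>w\<close> would have to be the predecessor of
      \<open>v\<close>.\<close>
    have no: False if x: "x \<in> R" "x < v" "adj ?F v x" "\<nexists>q. p = q @ [x, v]" for x
    proof -
      have "did_path R (p @ [x])" using good[OF forest_path_snoc[OF forest p(1) x(3,4)]] p(2) by blast
      moreover have "p \<noteq> []" "last p = v" using p(1) by (auto simp: is_path_def)
      ultimately have "desc_ok v x" "child_ok R v x" by (auto simp: did_path_snoc)
      then show False using x R by (auto simp: desc_ok_def child_ok_def split: if_splits)
    qed
    obtain q where "p = q @ [u, v]" using no[of u] uv adj by blast
    then have "\<nexists>q. p = q @ [w, v]" using uv by auto
    then show False using no[of w] uv adj by blast
  qed
  moreover have False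
    if abcd: "{a, b} \<in> E" "{b, c} \<in> E" "{c, d} \<in> E" "odd a" "even b" "odd c" "even d" "a < c" "b < d" for a b c d
  proof -
    have adj: "adj ?F b a" "adj ?F b c" "adj ?F c d" using abcd by (auto simp: adj_def insert_commute)
    have "b \<in> V" using simple_graph_adjD(1)[OF s adj(1)] by simp
    then obtain p r where p: "is_path ?F p r b" "\<forall>w. reach ?F r w \<longrightarrow> r \<le> w"
      using path by blast
    have b: "p \<noteq> []" "last p = b" using p(1) by (auto simp: is_path_def)
    show False
    \<comment> \<open>If \<open>c\<close> is the parent of \<open>b\<close>, then \<open>a\<close>
      is a descendant of the odd vertex \<open>c\<close> although \<open>a < c\<close>. Otherwise
      the path continues through \<open>c\<close> to \<open>d\<close>, a descendant of the even
      vertex \<open>b\<close> although \<open>b < d\<close>.\<close>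
    proof (cases "\<exists>q. p = q @ [c, b]")
      case True
      then have "\<nexists>q. p = q @ [a, b]" using abcd by auto
      then have "did_path R (p @ [a])" using good[OF forest_path_snoc[OF forest p(1) adj(1)]] p(2) by blast
      then have "desc_ok c a" using True by (auto simp: did_path_snoc)
      then show False using abcd by (simp add: desc_ok_def)
    next
      case False
      have p': "is_path ?F (p @ [c]) r c" using forest_path_snoc[OF forest p(1) adj(2) False] .
      have "\<nexists>q. p @ [c] = q @ [d, c]" using b abcd by auto
      then have "did_path R ((p @ [c]) @ [d])"
        using good[OF forest_path_snoc[OF forest p' adj(3)]] p(2) by blast
      then have "desc_ok b d" using b unfolding did_path_snoc by (metis UnCI last_in_set set_append)
      then show False using abcd by (simp add: desc_ok_def)
    qed
  qed
  ultimately show ?thesis by (rule nbc_edgesI)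
qed

section \<open>From forbidden patterns back to forests\<close>

lemma cycle_two_neighbours:
  assumes "is_cycle G p" "v \<in> set p"
  shows "\<exists>u w. u \<in> set p \<and> w \<in> set p \<and> u \<noteq> w \<and> adj G v u \<and> adj G v w"
proof -
  have p: "3 \<le> length p" "distinct p" "successively (adj G) p" "adj G (last p) (hd p)"
    using assms(1) by (auto simp: is_cycle_def is_path_def)
  obtain q r where qr: "p = q @ v # r" using assms(2) split_list by fastforce
  show ?thesis
  proof (cases "q = []")
    case True
    then obtain c r' where "r = c # r'" "r' \<noteq> []" using p(1) qr
      by (cases r; cases "tl r") auto
    moreover from this have "last r' \<in> set r'" by simp
    ultimately show ?thesis using p qr True adj_sym[of G "last r'" v]
      by (intro exI[of _ c] exI[of _ "last r'"]) (auto simp: successively_Cons)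
  next
    case q: False
    show ?thesis
    proof (cases "r = []")
      case True
      then obtain c q' where "q = c # q'" "q' \<noteq> []" using p(1) qr by (cases q; cases "tl q") auto
      moreover from this have "last q' \<in> set q'" "adj G (last q') v"
        using p(3) qr True by (auto simp: successively_append_iff successively_Cons)
      ultimately show ?thesis using p qr True adj_sym[of G "last q'" v]
        by (intro exI[of _ c] exI[of _ "last q'"]) (auto simp: successively_append_iff)
    next
      case False
      then show ?thesis using p qr q adj_sym[of G "last q" v]
        by (intro exI[of _ "last q"] exI[of _ "hd r"])
          (auto simp: successively_append_iff successively_Cons dest: last_in_set hd_in_set)
    qed
  qed
qed

text \<open>Walking around a cycle two steps at a time, the odd vertices outside \<open>R\<close>
  would increase for ever. The set \<open>Q\<close> collects the vertices from which such a walk can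
  be continued: it is finite and nonempty, yet has no largest element.\<close>

lemma nbc_edges_acyclic:
  assumes nbc: "nbc_edges R E" and s: "simple_graph (V, E)"
    and R: "R = odds_upto m"
  shows "\<not> is_cycle (V, E) p"
proof
  assume cyc: "is_cycle (V, E) p"
  let ?S = "set p"
  have ne: "?S \<noteq> {}" using cyc by (auto simp: is_cycle_def)
  have edge: "odd u \<and> (even v \<or> u \<in> R \<and> v \<in> R)" if "{u, v} \<in> E" "u < v" for u v
    using nbc that unfolding nbc_edges_def by blast
  have tri: "\<not> (u < v \<and> w < v)" if "{u, v} \<in> E" "{v, w} \<in> E" "u \<noteq> w" "u \<in> R" "w \<in> R" for u v w
    using nbc that unfolding nbc_edges_def by blast
  have quad: "\<not> b < d" if "{a, b} \<in> E" "{b, c} \<in> E" "{c, d} \<in> E" "odd a" "even b" "odd c" "even d" "a < c" for a b c d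
    using nbc that unfolding nbc_edges_def by blast
  have neq: "u \<noteq> v" if "{u, v} \<in> E" for u v
    using simple_graph_adjD(3)[OF s, of u v] that by (simp add: adj_def)
  have nbs: "\<exists>u w. u \<in> ?S \<and> w \<in> ?S \<and> u \<noteq> w \<and> {v, u} \<in> E \<and> {v, w} \<in> E" if "v \<in> ?S" for v
    using cycle_two_neighbours[OF cyc that] by (simp add: adj_def)
  have other: "\<exists>w\<in>?S. w \<noteq> u \<and> {v, w} \<in> E" if "v \<in> ?S" for u v
    using nbs[OF that] by metis
  define Q where "Q = {c \<in> ?S. odd c \<and> c \<notin> R \<and> (\<exists>a b. b \<in> ?S \<and> even b \<and> odd a \<and> a < c \<and> {a, b} \<in> E \<and> {b, c} \<in> E)}"
  have R_down: "a \<in> R" if "c \<in> R" "odd a" "a < c" for a c using that by (auto simp: R odds_upto_def)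
  have "Q \<noteq> {}"
  proof -
    \<comment> \<open>The largest vertex of the cycle has two smaller neighbours, not both in
      \<open>R\<close>. So it is even, and the larger neighbour lies outside \<open>R\<close> and
      belongs to \<open>Q\<close>.\<close>
    define v where "v = Max ?S"
    have v: "v \<in> ?S" "\<And>x. x \<in> ?S \<Longrightarrow> x \<le> v" using ne by (auto simp: v_def)
    obtain x y where xy: "x \<in> ?S" "y \<in> ?S" "x \<noteq> y" "{v, x} \<in> E" "{v, y} \<in> E"
      using nbs[OF v(1)] by blast
    define u w where "u = min x y" and "w = max x y"
    have uw: "u \<in> ?S" "w \<in> ?S" "u < w" "{u, v} \<in> E" "{v, w} \<in> E"
      using xy by (auto simp: u_def w_def min_def max_def insert_commute)
    have lt: "u < v" "w < v" using v(2)[of u] v(2)[of w] uw neq[of u v] neq[of v w] by auto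
    have "{w, v} \<in> E" using uw by (simp add: insert_commute)
    have not_both: "\<not> (u \<in> R \<and> w \<in> R)" using tri[of u v w] uw lt by auto
    have o: "odd u" "odd w" "even v"
      using edge[of u v] edge[of w v] \<open>{w, v} \<in> E\<close> uw lt not_both by auto
    then have "w \<notin> R" using not_both R_down[of w u] uw by blast
    then have "w \<in> Q" using uw o v by (auto simp: Q_def)
    then show ?thesis by blast
  qed
  moreover have "\<exists>c'\<in>Q. c < c'" if "c \<in> Q" for c
  proof -
    obtain a b where ab: "c \<in> ?S" "odd c" "c \<notin> R" "b \<in> ?S" "even b" "odd a" "a < c" "{a, b} \<in> E" "{b, c} \<in> E"
      using \<open>c \<in> Q\<close> by (auto simp: Q_def)
    obtain d where d: "d \<in> ?S" "d \<noteq> b" "{c, d} \<in> E" using other[OF ab(1)] by blast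
    have "{d, c} \<in> E" using d by (simp add: insert_commute)
    then have "even d" using edge[of c d] edge[of d c] ab d neq[of c d] by (cases "c < d") auto
    then have "d < b" using quad[of a b c d] ab d by auto
    obtain c' where c': "c' \<in> ?S" "c' \<noteq> c" "{d, c'} \<in> E" using other[OF d(1)] by blast
    have c'd: "{c', d} \<in> E" "{c, b} \<in> E" using c' ab by (simp_all add: insert_commute)
    then have "odd c'" using edge[of c' d] edge[of d c'] c' \<open>even d\<close> neq[of d c'] by (cases "c' < d") auto
    \<comment> \<open>Read backwards, the path \<open>c'\<close>, \<open>d\<close>,
      \<open>c\<close>, \<open>b\<close> would be the forbidden pattern, since
      \<open>d < b\<close>.\<close>
    have "\<not> c' < c" using quad[of c' d c b] \<open>{d, c} \<in> E\<close> c'd \<open>odd c'\<close> \<open>even d\<close> ab \<open>d < b\<close> by auto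
    then have "c < c'" using c' by simp
    then have "c' \<notin> R" using R_down ab by blast
    then have "c' \<in> Q" using c' \<open>odd c'\<close> \<open>c < c'\<close> \<open>even d\<close> d ab unfolding Q_def by blast
    then show ?thesis using \<open>c < c'\<close> by blast
  qed
  moreover have "finite Q" by (simp add: Q_def)
  ultimately show False by (metis Max_ge Max_in leD)
qed

text \<open>Membership in \<open>R\<close> is inherited by parents: even vertices have no children
  in \<open>R\<close>, and an odd vertex with an odd child is itself in \<open>R\<close>.\<close>

lemma did_path_R:
  assumes "successively (child_ok R) (p @ [v])" "v \<in> R" "\<And>v. v \<in> R \<Longrightarrow> odd v" "y \<in> set p"
  shows "y \<in> R"
  using assms
proof (induction p arbitrary: v rule: rev_induct)
  case (snoc x p)
  have "child_ok R x v" using snoc.prems by (simp add: successively_append_iff)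
  then have x: "x \<in> R" using snoc.prems by (auto simp: child_ok_def split: if_splits)
  moreover have "successively (child_ok R) (p @ [x])" using snoc.prems by (simp add: successively_append_iff)
  ultimately show ?case using snoc.IH[of x] snoc.prems by auto
qed simp

text \<open>Let the path end in \<open>x\<close>, \<open>v\<close>, \<open>w\<close>. If
  \<open>v\<close> is in \<open>R\<close>, everything before it is in \<open>R\<close> and
  increasing, and \<open>w\<close> exceeds it all. Otherwise the patterns force \<open>w\<close>
  strictly between \<open>x\<close> and \<open>v\<close>, so that an earlier vertex, already
  compared with both, compares with \<open>w\<close> in the same way.\<close>

lemma did_path_if_nbc_edges:
  assumes nbc: "nbc_edges R E" and s: "simple_graph (V, E)" and R: "R = odds_upto m"
    and min: "\<And>w. reach (V, E) u w \<Longrightarrow> u \<le> w"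
    and "is_path (V, E) p u v"
  shows "did_path R p"
  using assms(5)
proof (induction p arbitrary: v rule: rev_induct)
  case Nil
  then show ?case by (simp add: is_path_def)
next
  case (snoc w p v')
  have edge: "odd u \<and> (even v \<or> u \<in> R \<and> v \<in> R)" if "{u, v} \<in> E" "u < v" for u v
    using nbc that unfolding nbc_edges_def by blast
  have tri: "\<not> (u < v \<and> w < v)" if "{u, v} \<in> E" "{v, w} \<in> E" "u \<noteq> w" "u \<in> R" "w \<in> R" for u v w
    using nbc that unfolding nbc_edges_def by blast
  have quad: "\<not> b < d" if "{a, b} \<in> E" "{b, c} \<in> E" "{c, d} \<in> E" "odd a" "even b" "odd c" "even d" "a < c" for a b c d
    using nbc that unfolding nbc_edges_def by blast
  have R_down: "a \<in> R" if "c \<in> R" "odd a" "a < c" for a c using that by (auto simp: R odds_upto_def)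
  have R_odd: "odd a" if "a \<in> R" for a using that by (auto simp: R odds_upto_def)
  have [simp]: "v' = w" using snoc.prems by (simp add: is_path_def)
  have uw: "u \<le> w" using min reach_if_path[OF snoc.prems] by simp
  show ?case
  proof (cases "p = []")
    case True
    then show ?thesis by (simp add: did_path_def)
  next
    case False
    have path: "is_path (V, E) p u (last p)" using is_path_appendD(1)[OF snoc.prems False] .
    then have IH: "did_path R p" by (rule snoc.IH)
    define v where "v = last p"
    obtain q where q: "p = q @ [v]" using False by (metis append_butlast_last_id v_def)
    have vw: "{v, w} \<in> E" "{w, v} \<in> E" "v \<noteq> w"
      using snoc.prems q by (auto simp: is_path_def successively_append_iff adj_def insert_commute)
    have IH': "did_path R q" "\<forall>y\<in>set q. desc_ok y v" using IH by (auto simp: q did_path_snoc)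
    show ?thesis
    proof (cases "q = []")
      case True
      then have "v = u" using path q by (simp add: is_path_def)
      then have "v < w" using vw uw by simp
      then have "desc_ok v w" "child_ok R v w"
        using edge[OF vw(1)] by (auto simp: desc_ok_def child_ok_def)
      then show ?thesis using True q by (simp add: did_path_def)
    next
      case False
      define x where "x = last q"
      obtain r where r: "q = r @ [x]" using False by (metis append_butlast_last_id x_def)
      have xv: "{x, v} \<in> E" "{v, x} \<in> E" "x \<noteq> w"
        using snoc.prems q r by (auto simp: is_path_def successively_append_iff adj_def insert_commute)
      have dx: "desc_ok x v" "child_ok R x v" "\<forall>y\<in>set r. desc_ok y x" "\<forall>y\<in>set r. desc_ok y v"
        using IH by (auto simp: q r did_path_def sorted_wrt_append successively_append_iff)
      have ux: "u = x" if "r = []" using that path q r by (simp add: is_path_def)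
      have z: "\<exists>z. z \<in> set r \<and> {z, x} \<in> E \<and> {x, z} \<in> E \<and> child_ok R z x" if "r \<noteq> []"
        using that snoc.prems IH q r
        by (intro exI[of _ "last r"])
          (auto simp: is_path_def did_path_def successively_append_iff adj_def insert_commute)
      have "desc_ok v w \<and> child_ok R v w \<and> desc_ok x w \<and> (\<forall>y\<in>set r. desc_ok y w)"
      proof (cases "odd v")
        case v: True
        show ?thesis
        proof (cases "v \<in> R")
          case True
          then have "x \<in> R" using v dx(2) by (auto simp: child_ok_def split: if_splits)
          then have "x < v" using dx(1) R_odd by (auto simp: desc_ok_def split: if_splits)
          have "v < w"
          proof (rule ccontr)
            assume "\<not> v < w"
            then have "w < v" using vw by simp
            then have "w \<in> R" using edge[OF vw(2)] v by blast
            then show False using tri[OF xv(1) vw(1) xv(3) \<open>x \<in> R\<close>] \<open>x < v\<close> \<open>w < v\<close> by blast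
          qed
          moreover have "even w \<or> w \<in> R" using edge[OF vw(1) \<open>v < w\<close>] by blast
          moreover have "odd y" if "y \<in> set q" for y
            using did_path_R[of R q v y] IH True that R_odd unfolding did_path_def q by blast
          ultimately show ?thesis using v True IH'(2)
            by (auto simp: r desc_ok_def child_ok_def)
        next
          case vR: False
          have x: "even x" using dx(2) v vR by (auto simp: child_ok_def split: if_splits)
          have "v < w" using edge[OF vw(2)] v vR vw(3) by (cases "v < w") auto
          then have w: "even w" using edge[OF vw(1)] vR by blast
          have "v < x" using dx(1) x by (simp add: desc_ok_def)
          \<comment> \<open>Otherwise \<open>x\<close> is the root, which is minimal, while
            \<open>v < x\<close> because \<open>x\<close> is even.\<close>
          have "r \<noteq> []"
          proof
            assume "r = []"
            then have "x \<le> v" using ux min reach_if_path[OF path] by (simp add: v_def)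
            then show False using \<open>v < x\<close> by simp
          qed
          then obtain z where z: "z \<in> set r" "{z, x} \<in> E" "child_ok R z x" using z by blast
          have "odd z" using z(3) x by (auto simp: child_ok_def split: if_splits)
          then have "z < v" using dx(4) z(1) by (auto simp: desc_ok_def)
          then have "w < x" using quad[OF z(2) xv(1) vw(1) \<open>odd z\<close> x v w] xv(3) by simp
          then show ?thesis using dx v x w \<open>v < w\<close>
            by (auto simp: desc_ok_def child_ok_def split: if_splits dest!: bspec)
        qed
      next
        case v: False
        have x: "odd x" using dx(2) v by (auto simp: child_ok_def split: if_splits)
        then have "x < v" using dx(1) by (simp add: desc_ok_def)
        have "w < v" using edge[OF vw(1)] v vw(3) by (cases "v < w") auto
        then have w: "odd w" using edge[OF vw(2)] by blast
        have not_both: "\<not> (x \<in> R \<and> w \<in> R)" using tri[OF xv(1) vw(1) xv(3)] \<open>x < v\<close> \<open>w < v\<close> by blast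
        \<comment> \<open>If \<open>w < x\<close>, then \<open>x\<close> is neither in
          \<open>R\<close> nor the root, so its parent \<open>z\<close> is even and above
          \<open>v\<close>, and the path \<open>w\<close>, \<open>v\<close>, \<open>x\<close>,
          \<open>z\<close> is forbidden.\<close>
        have "x < w"
        proof (rule ccontr)
          assume "\<not> x < w"
          then have "w < x" using xv(3) by simp
          then have "x \<notin> R" using not_both R_down w by blast
          have "r \<noteq> []" using ux uw \<open>w < x\<close> by auto
          then obtain z where z: "z \<in> set r" "{x, z} \<in> E" "child_ok R z x" using z by blast
          have "even z" using z(3) x \<open>x \<notin> R\<close> by (auto simp: child_ok_def split: if_splits)
          then have "v < z" using dx(4) z(1) by (auto simp: desc_ok_def)
          then show False using quad[OF vw(2) xv(2) z(2) w _ x \<open>even z\<close> \<open>w < x\<close>] v by simp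
        qed
        moreover have "w \<notin> R" using not_both R_down[of w x] x \<open>x < w\<close> by blast
        ultimately show ?thesis using dx v x w \<open>w < v\<close>
          by (auto simp: desc_ok_def child_ok_def split: if_splits dest!: bspec)
      qed
      then show ?thesis unfolding did_path_snoc[of R p w] using IH by (auto simp: q r)
    qed
  qed
qed

text \<open>The direction from patterns to forests relies on \<open>R\<close> being an initial
  segment of the odd numbers: if the larger of two odd vertices is in \<open>R\<close>, so is the
  smaller.\<close>

theorem did_forest_iff_nbc_edges:
  assumes s: "simple_graph (V, E)" and V: "0 \<notin> V" and R: "R = odds_upto m"
  shows "did_forest R (V, E) \<longleftrightarrow> nbc_edges R E"
proof
  assume "did_forest R (V, E)"
  then show "nbc_edges R E" by (rule nbc_edges_if_did_forest) (simp add: R odds_upto_def)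
next
  assume nbc: "nbc_edges R E"
  have "is_forest (V, E)" using s nbc_edges_acyclic[OF nbc s R] by (auto simp: is_forest_def)
  then show "did_forest R (V, E)"
    unfolding did_forest_iff using V did_path_if_nbc_edges[OF nbc s R] by (metis fst_conv)
qed

section \<open>The graphs \<open>\<Gamma>\<close>\<close>

lemma odds_upto_down: "c \<in> odds_upto m \<Longrightarrow> odd a \<Longrightarrow> a < c \<Longrightarrow> a \<in> odds_upto m"
  by (simp add: odds_upto_def)

lemma verts_Gamma: "verts (Gamma n m) = {1..2*n-1}"
  by (simp add: Gamma_def)

text \<open>Since 2i-1 < 2j holds iff i \<le> j, an odd and an even vertex are adjacent exactly when
  the odd one is smaller. The bound on \<open>m\<close> keeps the vertices of \<open>R\<close>
  inside the vertex set.\<close>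

lemma Gamma_edge_iff:
  assumes "m \<le> 2*n-1" "u < v"
  shows "{u, v} \<in> edges (Gamma n m) \<longleftrightarrow>
    1 \<le> u \<and> v \<le> 2*n-1 \<and> odd u \<and> (even v \<or> u \<in> odds_upto m \<and> v \<in> odds_upto m)"
proof
  assume "{u, v} \<in> edges (Gamma n m)"
  then consider i j where "{u, v} = {2*i-1, 2*j}" "1 \<le> i" "i \<le> j" "j \<le> n-1"
    | i j where "{u, v} = {i, j}" "i \<in> odds_upto m" "j \<in> odds_upto m" "i < j"
    unfolding Gamma_def by auto
  then show "1 \<le> u \<and> v \<le> 2*n-1 \<and> odd u \<and> (even v \<or> u \<in> odds_upto m \<and> v \<in> odds_upto m)"
  proof cases
    case 1
    then have "u = 2*i-1" "v = 2*j" using assms(2) by (auto simp: doubleton_eq_iff)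
    then show ?thesis using 1(2-4) by auto
  next
    case 2
    then have "u = i" "v = j" using assms(2) by (auto simp: doubleton_eq_iff)
    then show ?thesis using 2(2-4) assms(1) by (auto simp: odds_upto_def intro: Suc_leI odd_pos)
  qed
next
  assume asm: "1 \<le> u \<and> v \<le> 2*n-1 \<and> odd u \<and> (even v \<or> u \<in> odds_upto m \<and> v \<in> odds_upto m)"
  show "{u, v} \<in> edges (Gamma n m)"
  proof (cases "even v")
    case True
    obtain i where i: "u = 2*i+1" using asm by (blast elim: oddE)
    obtain j where j: "v = 2*j" using True by (blast elim: evenE)
    have "v \<le> 2*n-1" using asm by blast
    then have "u = 2*(i+1) - 1" "1 \<le> i+1" "i+1 \<le> j" "j \<le> n-1" using i j assms(2) by auto
    then have "{u, v} \<in> {{2*i-1, 2*j} | i j. 1 \<le> i \<and> i \<le> j \<and> j \<le> n-1}" using j by blast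
    then show ?thesis unfolding Gamma_def snd_conv by (rule UnI1)
  next
    case False
    then show ?thesis using asm assms(2) by (auto simp: Gamma_def)
  qed
qed

lemma simple_graph_Gamma:
  assumes "m \<le> 2*n-1"
  shows "simple_graph (Gamma n m)"
proof -
  have "e \<subseteq> {1..2*n-1} \<and> card e = 2" if e: "e \<in> edges (Gamma n m)" for e
  proof -
    obtain u v where uv: "e = {u, v}" "u < v"
    proof -
      from e consider i j where "e = {2*i-1, 2*j}" "1 \<le> i" "i \<le> j"
        | i j where "e = {i, j}" "i < j"
        unfolding Gamma_def by auto
      then show ?thesis
      proof cases
        case 1
        then have "2*i-1 < 2*j" by linarith
        then show ?thesis using that 1(1) by blast
      qed (rule that)
    qed
    then show ?thesis using Gamma_edge_iff[OF assms uv(2)] e by auto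
  qed
  then show ?thesis by (simp add: simple_graph_def verts_Gamma)
qed

text \<open>The first clause of \<open>nbc_edges\<close> is the adjacency condition of the graph, so
  the forests are automatically subgraphs of it.\<close>

lemma did_forests_on_eq:
  assumes m: "m \<le> 2*n-1"
  shows "did_forests_on (odds_upto m) (2*n-1) =
    Pair {1..2*n-1} ` {E. E \<subseteq> edges (Gamma n m) \<and> nbc_edges (odds_upto m) E}"
proof (intro set_eqI iffI)
  fix F assume F: "F \<in> did_forests_on (odds_upto m) (2*n-1)"
  then obtain E where E: "F = ({1..2*n-1}, E)" by (cases F) (auto simp: did_forests_on_def)
  then have did: "did_forest (odds_upto m) ({1..2*n-1}, E)" using F by (simp add: did_forests_on_def)
  then have s: "simple_graph ({1..2*n-1}, E)" by (simp add: did_forest_def is_forest_def)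
  then have nbc: "nbc_edges (odds_upto m) E" using did did_forest_iff_nbc_edges[OF s] by simp
  have "e \<in> edges (Gamma n m)" if e: "e \<in> E" for e
  proof -
    obtain x y where "e = {x, y}" "x \<noteq> y" using s e by (auto simp: simple_graph_def card_2_iff)
    then obtain u v where uv: "e = {u, v}" "u < v" by (metis insert_commute linorder_neqE_nat)
    then have "1 \<le> u" "v \<le> 2*n-1" using s e by (auto simp: simple_graph_def)
    moreover have "odd u \<and> (even v \<or> u \<in> odds_upto m \<and> v \<in> odds_upto m)"
      using nbc uv e unfolding nbc_edges_def by blast
    ultimately show ?thesis using Gamma_edge_iff[OF m uv(2)] uv(1) by simp
  qed
  then show "F \<in> Pair {1..2*n-1} ` {E. E \<subseteq> edges (Gamma n m) \<and> nbc_edges (odds_upto m) E}"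
    using E nbc by blast
next
  fix F assume "F \<in> Pair {1..2*n-1} ` {E. E \<subseteq> edges (Gamma n m) \<and> nbc_edges (odds_upto m) E}"
  then obtain E where E: "F = ({1..2*n-1}, E)" "E \<subseteq> edges (Gamma n m)" "nbc_edges (odds_upto m) E" by blast
  then have s: "simple_graph ({1..2*n-1}, E)"
    using simple_graph_subgraph[OF simple_graph_Gamma[OF m], of E] by (simp add: verts_Gamma)
  then show "F \<in> did_forests_on (odds_upto m) (2*n-1)"
    using E did_forest_iff_nbc_edges[OF s] by (simp add: did_forests_on_def)
qed

lemma nbc_edges_subset: "nbc_edges R E' \<Longrightarrow> E \<subseteq> E' \<Longrightarrow> nbc_edges R E"
  unfolding nbc_edges_def by (meson subsetD)

text \<open>
  The toggled edge is the smallest edge of a nontrivial block: it joins the least vertex to the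
  next vertex of \<open>\<R>\<close> if there is one, and to the largest even vertex otherwise.
\<close>

lemma nbc_edges_toggle:
  assumes m: "m \<le> 2*n-1" and \<pi>: "\<pi> \<in> bond_lattice (Gamma n m)" "\<pi> \<noteq> bond_bot (Gamma n m)"
  shows "\<exists>e\<in>edges_within (Gamma n m) \<pi>. \<forall>E\<subseteq>edges_within (Gamma n m) \<pi>.
    nbc_edges (odds_upto m) E \<longrightarrow> nbc_edges (odds_upto m) (insert e E)"
proof -
  let ?G = "Gamma n m" and ?R = "odds_upto m"
  have s: "simple_graph ?G" using simple_graph_Gamma[OF m] .
  have part: "partition_on (verts ?G) \<pi>" using \<pi> by (simp add: bond_lattice_def)
  have "edges_within ?G \<pi> \<noteq> {}"
    using components_edges_within[OF s \<pi>(1)] \<pi>(2) bond_bot_eq[OF s] by auto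
  then obtain f B where f: "f \<in> edges ?G" "B \<in> \<pi>" "f \<subseteq> B" by (auto simp: edges_within_def)
  have B: "B \<subseteq> {1..2*n-1}" using f partition_onD1[OF part] by (auto simp: verts_Gamma)
  then have finB: "finite B" by (rule finite_subset) simp
  have "card f = 2" using s f by (auto simp: simple_graph_def)
  then have "2 \<le> card B" using card_mono[OF finB f(3)] by simp
  define a where "a = Min B"
  have neB: "B \<noteq> {}" using \<open>2 \<le> card B\<close> by auto
  have a: "a \<in> B" "\<And>x. x \<in> B \<Longrightarrow> a \<le> x" using finB neB by (auto simp: a_def)
  have "\<not> B \<subseteq> {a}" using \<open>2 \<le> card B\<close> card_mono[of "{a}" B] by auto
  then obtain y where y: "y \<in> B" "y \<noteq> a" by blast
  \<comment> \<open>Connectedness gives the least vertex \<open>a\<close> a neighbour in the block.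
    This makes \<open>a\<close> odd and supplies an even vertex when \<open>R\<close> offers no
    second one.\<close>
  have "\<exists>c\<in>B. {a, c} \<in> edges ?G \<and> a < c"
  proof -
    have "connected_graph (induced ?G B)" using \<pi>(1) f(2) by (simp add: bond_lattice_def)
    then obtain p where "is_path (induced ?G B) p a y"
      using a(1) y(1) by (auto simp: connected_graph_def induced_def)
    then have "reach (induced ?G B) a y" by (rule reach_if_path)
    then obtain c where "adj (induced ?G B) a c" using y(2) by (metis converse_rtranclpE)
    then have c: "c \<in> B" "{a, c} \<in> edges ?G" by (auto simp: adj_def induced_def)
    then have "a \<noteq> c" using simple_graph_adjD(3)[OF s, of a c] by (simp add: adj_def)
    then show ?thesis using c a(2)[of c] by auto
  qed
  then obtain c where c: "c \<in> B" "{a, c} \<in> edges ?G" "a < c" by blast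
  have ac: "1 \<le> a" "odd a" "even c \<or> a \<in> ?R \<and> c \<in> ?R" using c Gamma_edge_iff[OF m c(3)] by auto
  have block: "g \<subseteq> B" if g: "g \<in> edges_within ?G \<pi>" "x \<in> g" "x \<in> B" for g x
  proof -
    obtain B' where "B' \<in> \<pi>" "g \<subseteq> B'" using g(1) by (auto simp: edges_within_def)
    moreover from this have "B' = B" using g f(2) disjointD[OF partition_onD2[OF part], of B' B] by blast
    ultimately show ?thesis by simp
  qed
  \<comment> \<open>Patterns avoiding \<open>e\<close> are excluded already in \<open>E\<close>; by
    the symmetry of the first pattern, \<open>e\<close> may be taken as its edge
    \<open>{u, v}\<close>.\<close>
  have nbcI: "nbc_edges ?R (insert e E)"
    if e: "e \<in> edges_within ?G \<pi>" and E: "E \<subseteq> edges_within ?G \<pi>" and nbc: "nbc_edges ?R E"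
      and tri: "\<And>u v w. {u, v} = e \<Longrightarrow> {v, w} \<in> insert e E \<Longrightarrow> u \<noteq> w \<Longrightarrow> u \<in> ?R \<Longrightarrow> w \<in> ?R \<Longrightarrow>
        u < v \<Longrightarrow> w < v \<Longrightarrow> False"
      and quad: "\<And>u v w x. {u, v} \<in> insert e E \<Longrightarrow> {v, w} \<in> insert e E \<Longrightarrow> {w, x} \<in> insert e E \<Longrightarrow>
        odd u \<Longrightarrow> even v \<Longrightarrow> odd w \<Longrightarrow> even x \<Longrightarrow> u < w \<Longrightarrow> v < x \<Longrightarrow>
        {u, v} = e \<or> {v, w} = e \<or> {w, x} = e \<Longrightarrow> False"
    for e E
  proof -
    have sub: "insert e E \<subseteq> edges ?G" using e E edges_within_subset by blast
    have "odd u \<and> (even v \<or> u \<in> ?R \<and> v \<in> ?R)" if "{u, v} \<in> insert e E" "u < v" for u v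
      using Gamma_edge_iff[OF m that(2)] sub that(1) by blast
    moreover have False
      if h: "{u, v} \<in> insert e E" "{v, w} \<in> insert e E" "u \<noteq> w" "u \<in> ?R" "w \<in> ?R" "u < v" "w < v" for u v w
    proof -
      consider "{u, v} = e" | "{w, v} = e" | "{u, v} \<in> E" "{v, w} \<in> E"
        using h(1,2) by (auto simp: insert_commute)
      then show False
      proof cases
        case 1 then show False using tri h by blast
      next
        case 2
        have "{v, u} \<in> insert e E" using h(1) by (simp add: insert_commute)
        then show False using tri[OF 2] h by blast
      next
        case 3 then show False using nbc h unfolding nbc_edges_def by blast
      qed
    qed
    moreover have False
      if h: "{u, v} \<in> insert e E" "{v, w} \<in> insert e E" "{w, x} \<in> insert e E"
        "odd u" "even v" "odd w" "even x" "u < w" "v < x" for u v w x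
    proof (cases "{u, v} = e \<or> {v, w} = e \<or> {w, x} = e")
      case True then show False using quad[OF h] by blast
    next
      case False
      then have "{u, v} \<in> E" "{v, w} \<in> E" "{w, x} \<in> E" using h by auto
      then show False using nbc h unfolding nbc_edges_def by blast
    qed
    ultimately show ?thesis by (rule nbc_edgesI)
  qed
  show ?thesis
  proof (cases "B \<inter> ?R - {a} = {}")
    case False
    define a' where "a' = Min (B \<inter> ?R - {a})"
    have "finite (B \<inter> ?R - {a})" using finB by simp
    then have a': "a' \<in> B" "a' \<in> ?R" "a' \<noteq> a" "\<And>x. x \<in> B \<Longrightarrow> x \<in> ?R \<Longrightarrow> x \<noteq> a \<Longrightarrow> a' \<le> x"
      using Min_in[of "B \<inter> ?R - {a}"] False by (auto simp: a'_def)
    have lt: "a < a'" using a(2)[OF a'(1)] a'(3) by simp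
    have "a \<in> ?R" using odds_upto_down[OF a'(2) ac(2) lt] .
    then have "{a, a'} \<in> edges ?G" using Gamma_edge_iff[OF m lt] a'(1,2) ac B by auto
    then have e: "{a, a'} \<in> edges_within ?G \<pi>" using a'(1) a(1) f(2) unfolding edges_within_def by blast
    have "odd a'" using a'(2) by (simp add: odds_upto_def)
    \<comment> \<open>In the first pattern \<open>a'\<close> is the top vertex, and the other edge
      leads to a vertex of \<open>R\<close> in \<open>B\<close> below \<open>a'\<close> and
      different from \<open>a\<close>, against minimality. The second pattern has no edge between
      odd vertices.\<close>
    have "nbc_edges ?R (insert {a, a'} E)" if E: "E \<subseteq> edges_within ?G \<pi>" and nbc: "nbc_edges ?R E" for E
    proof (rule nbcI[OF e E nbc])
      fix u v w assume h: "{u, v} = {a, a'}" "{v, w} \<in> insert {a, a'} E" "u \<noteq> w" "w \<in> ?R" "u < v" "w < v"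
      then have uv: "u = a" "v = a'" using lt by (auto simp: doubleton_eq_iff)
      have "{v, w} \<in> edges_within ?G \<pi>" using subsetD[OF _ h(2)] e E by simp
      then have "w \<in> B" using block[of "{v, w}" v] uv a'(1) by simp
      then show False using a'(4)[of w] h uv by auto
    next
      fix u v w x :: nat
      assume "odd u" "even v" "odd w" "even x" "{u, v} = {a, a'} \<or> {v, w} = {a, a'} \<or> {w, x} = {a, a'}"
      then show False using ac(2) \<open>odd a'\<close> by (auto simp: doubleton_eq_iff)
    qed
    then show ?thesis using e by blast
  next
    case True
    then have "even c" using ac(3) c by auto
    define b where "b = Max {x\<in>B. even x}"
    have fin: "finite {x\<in>B. even x}" using finB by simp
    then have b: "b \<in> B" "even b" "\<And>x. x \<in> B \<Longrightarrow> even x \<Longrightarrow> x \<le> b"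
      using Max_in[OF fin] c(1) \<open>even c\<close> by (auto simp: b_def)
    have lt: "a < b" using b(3)[OF c(1) \<open>even c\<close>] c(3) by simp
    then have "{a, b} \<in> edges ?G" using Gamma_edge_iff[OF m lt] b(1,2) ac B by auto
    then have e: "{a, b} \<in> edges_within ?G \<pi>" using b(1) a(1) f(2) unfolding edges_within_def by blast
    \<comment> \<open>The first pattern needs two vertices of \<open>R\<close> in \<open>B\<close>.
      In the second all four vertices lie in \<open>B\<close>, so \<open>w\<close> exceeds
      \<open>u\<close>, hence is not \<open>a\<close>, and \<open>v\<close> is less than
      \<open>x\<close>, hence is not \<open>b\<close>; then none of the three edges can be
      \<open>{a, b}\<close>.\<close>
    have "nbc_edges ?R (insert {a, b} E)" if E: "E \<subseteq> edges_within ?G \<pi>" and nbc: "nbc_edges ?R E" for E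
    proof (rule nbcI[OF e E nbc])
      fix u v w assume h: "{u, v} = {a, b}" "{v, w} \<in> insert {a, b} E" "u \<noteq> w" "u \<in> ?R" "w \<in> ?R"
      have uv: "u \<in> B" "v \<in> B" using h(1) a(1) b(1) by (auto simp: doubleton_eq_iff)
      have "{v, w} \<in> edges_within ?G \<pi>" using subsetD[OF _ h(2)] e E by simp
      then have "w \<in> B" using block[of "{v, w}" v] uv by simp
      then have "u = a" "w = a" using True uv h(4,5) by auto
      then show False using h(3) by simp
    next
      fix u v w x :: nat
      assume h: "{u, v} \<in> insert {a, b} E" "{v, w} \<in> insert {a, b} E" "{w, x} \<in> insert {a, b} E"
        "odd u" "even v" "odd w" "even x" "u < w" "v < x"
        "{u, v} = {a, b} \<or> {v, w} = {a, b} \<or> {w, x} = {a, b}"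
      have ew: "{u, v} \<in> edges_within ?G \<pi>" "{v, w} \<in> edges_within ?G \<pi>" "{w, x} \<in> edges_within ?G \<pi>"
        using h(1-3)[THEN subsetD[rotated]] e E by simp_all
      have "v \<in> B \<or> w \<in> B" using h(10) a(1) b(1) by (auto simp: doubleton_eq_iff)
      then have "v \<in> B" "w \<in> B" using block[OF ew(2)] by auto
      then have "u \<in> B" "x \<in> B" using block[OF ew(1), of v] block[OF ew(3), of w] by auto
      then have "a \<le> u" "x \<le> b" using a(2) b(3) h(7) by auto
      then show False using h ac(2) b(2) by (auto simp: doubleton_eq_iff)
    qed
    then show ?thesis using e by blast
  qed
qed

theorem bond_moebius_Gamma:
  assumes n: "1 \<le> n" and m: "m \<le> 2*n-1" and \<pi>: "\<pi> \<in> bond_lattice (Gamma n m)"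
  shows "(-1) ^ (card \<pi> + 1) * bond_moebius (Gamma n m) (bond_bot (Gamma n m)) \<pi> =
    int (card {F \<in> did_forests_on (odds_upto m) (2*n-1). components F = \<pi>})"
proof -
  let ?G = "Gamma n m" and ?R = "odds_upto m" and ?V = "{1..2*n-1}"
  define L where "L = {E. E \<subseteq> edges ?G \<and> nbc_edges ?R E}"
  have s: "simple_graph ?G" using simple_graph_Gamma[OF m] .
  have forests: "did_forests_on ?R (2*n-1) = Pair ?V ` L" using did_forests_on_eq[OF m] by (simp add: L_def)
  have forest: "is_forest (?V, E)" if "E \<in> L" for E
  proof -
    have "(?V, E) \<in> did_forests_on ?R (2*n-1)" using that forests by simp
    then show ?thesis by (simp add: did_forests_on_def did_forest_def)
  qed
  let ?A = "{E. E \<in> L \<and> components (?V, E) = \<pi>}"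
  have "bond_moebius ?G (bond_bot ?G) \<pi> = (\<Sum>E | E \<in> L \<and> components (verts ?G, E) = \<pi>. (-1) ^ card E)"
  proof (rule bond_moebius_toggle[OF s _ _ _ _ \<pi>])
    show "L \<subseteq> Pow (edges ?G)" "{} \<in> L" by (auto simp: L_def nbc_edges_def)
    show "is_forest (verts ?G, E)" if "E \<in> L" for E using forest[OF that] by (simp add: verts_Gamma)
    fix \<pi> assume \<pi>: "\<pi> \<in> bond_lattice ?G" "\<pi> \<noteq> bond_bot ?G"
    obtain e where e: "e \<in> edges_within ?G \<pi>"
      "\<And>E. E \<subseteq> edges_within ?G \<pi> \<Longrightarrow> nbc_edges ?R E \<Longrightarrow> nbc_edges ?R (insert e E)"
      using nbc_edges_toggle[OF m \<pi>] by blast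
    have "insert e E \<in> L \<longleftrightarrow> E \<in> L" if "E \<subseteq> edges_within ?G \<pi>" for E
      using e that edges_within_subset[of ?G \<pi>] nbc_edges_subset[of ?R "insert e E" E]
      by (auto simp: L_def)
    then show "\<exists>e\<in>edges_within ?G \<pi>. \<forall>E\<subseteq>edges_within ?G \<pi>. insert e E \<in> L \<longleftrightarrow> E \<in> L"
      using e(1) by blast
  qed
  then have "(-1) ^ (card \<pi> + 1) * bond_moebius ?G (bond_bot ?G) \<pi> =
      (\<Sum>E\<in>?A. (-1) ^ (card \<pi> + 1) * (-1) ^ card E)"
    by (simp add: verts_Gamma sum_distrib_left)
  also have "\<dots> = (\<Sum>E\<in>?A. 1)"
  proof (rule sum.cong[OF refl])
    fix E assume E: "E \<in> ?A"
    then have "card E + card \<pi> = 2*n-1" using forest_card[OF forest[of E]] by simp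
    \<comment> \<open>The number of vertices is odd; the added 1 makes the total exponent
      even.\<close>
    then have "card \<pi> + 1 + card E = 2*n" using n by simp
    then show "(-1::int) ^ (card \<pi> + 1) * (-1) ^ card E = 1"
      by (simp only: power_add[symmetric]) simp
  qed
  also have "\<dots> = int (card ?A)" by simp
  also have "card ?A = card (Pair ?V ` ?A)" by (simp add: card_image inj_on_def)
  also have "Pair ?V ` ?A = {F \<in> did_forests_on ?R (2*n-1). components F = \<pi>}" using forests by auto
  finally show ?thesis .
qed

section \<open>Trees, the connected case and the final count\<close>

lemma components_connected:
  assumes "simple_graph G" "connected_graph G"
  shows "components G = {verts G}"
proof -
  have path: "\<exists>p. is_path G p u v" if "u \<in> verts G" "v \<in> verts G" for u v
    using assms(2) that by (auto simp: connected_graph_def)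
  have "{v. reach G u v} = verts G" if u: "u \<in> verts G" for u
    using reach_verts[OF assms(1) _ u] path[OF u] reach_if_path[of G _ u] by blast
  moreover have "verts G \<noteq> {}" using assms(2) by (simp add: connected_graph_def)
  ultimately show ?thesis by (auto simp: components_eq[OF assms(1)])
qed

lemma induced_verts: "simple_graph G \<Longrightarrow> induced G (verts G) = G"
  by (cases G) (auto simp: induced_def simple_graph_def)

lemma did_trees_on_eq: "did_trees_on R N = {F \<in> did_forests_on R N. components F = {{1..N}}}"
proof (intro set_eqI iffI)
  fix T assume "T \<in> did_trees_on R N"
  then have T: "did_tree R T" "verts T = {1..N}" by (simp_all add: did_trees_on_def)
  then have "is_tree T" by (simp add: did_tree_def)
  then have T': "is_forest T" "connected_graph T" by (simp_all add: is_tree_def)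
  then have s: "simple_graph T" by (simp add: is_forest_def)
  have "components T = {verts T}" using components_connected[OF s T'(2)] .
  moreover have "induced T (verts T) = T" using induced_verts[OF s] .
  ultimately have "did_forest R T" using T(1) T'(1) by (simp add: did_forest_def)
  then show "T \<in> {F \<in> did_forests_on R N. components F = {{1..N}}}"
    using T \<open>components T = {verts T}\<close> by (simp add: did_forests_on_def)
next
  fix F assume "F \<in> {F \<in> did_forests_on R N. components F = {{1..N}}}"
  then have F: "did_forest R F" "components F = {verts F}" "verts F = {1..N}"
    by (auto simp: did_forests_on_def)
  then have "simple_graph F" by (simp add: did_forest_def is_forest_def)
  then have "induced F (verts F) = F" by (rule induced_verts)
  then show "F \<in> did_trees_on R N" using F by (simp add: did_forest_def did_trees_on_def)
qed

text \<open>When \<open>R\<close> contains all odd vertices, vertex 1 is adjacent to every other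
  vertex.\<close>

lemma components_Gamma_full:
  assumes "1 \<le> n"
  shows "components (Gamma n (2*n-1)) = {{1..2*n-1}}"
proof -
  let ?G = "Gamma n (2*n-1)"
  have s: "simple_graph ?G" by (rule simple_graph_Gamma) simp
  have "reach ?G 1 v" if v: "v \<in> verts ?G" for v
  proof (cases "v = 1")
    case False
    then have "1 < v" "v \<le> 2*n-1" using v by (auto simp: verts_Gamma)
    then have "adj ?G 1 v"
      unfolding adj_def using Gamma_edge_iff[of "2*n-1" n 1 v] by (auto simp: odds_upto_def)
    then show ?thesis by blast
  qed simp
  then have conn: "reach ?G u v" if "u \<in> verts ?G" "v \<in> verts ?G" for u v
    using that reach_sym rtranclp_trans by metis
  have "reach ?G u v \<longleftrightarrow> v \<in> verts ?G" if u: "u \<in> verts ?G" for u v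
  proof
    assume "reach ?G u v"
    then show "v \<in> verts ?G" using u by (rule reach_verts[OF s])
  qed (rule conn[OF u])
  then have "{v. reach ?G u v} = verts ?G" if "u \<in> verts ?G" for u
    using that by simp
  then have "components ?G = (\<lambda>u. verts ?G) ` verts ?G"
    unfolding components_eq[OF s] by (intro image_cong refl)
  also have "\<dots> = {verts ?G}" using assms by (simp add: verts_Gamma image_constant_conv)
  finally show ?thesis by (simp add: verts_Gamma)
qed

text \<open>The exponent \<open>card \<pi> + 1\<close> is forced at the least element, where the
  Moebius function is 1 and the number of blocks is the odd number 2n-1. The statements about trees
  and the unshifted polynomial concern \<open>m = 2*n-1\<close>; for smaller \<open>m\<close> the
  greatest element has two blocks, and the factor \<open>monom 1 (card (bond_top G) - 1)\<close>
  makes up for the lower degree.\<close>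

theorem theorem1p1:
  fixes n m :: nat and R :: "nat set" and G :: "nat ugraph"
  assumes "1 \<le> n" and "odd m" and "1 \<le> m" and "m \<le> 2*n-1"
    and "R = odds_upto m" and "G = Gamma n m"
  shows "(\<forall>\<pi>\<in>bond_lattice G.
            (-1) ^ (card \<pi> + 1) * bond_moebius G (bond_bot G) \<pi>
              = int (card {F \<in> did_forests_on R (2*n-1). components F = \<pi>})) \<and>
         (m = 2*n-1 \<longrightarrow>
            bond_moebius G (bond_bot G) (bond_top G) = int (card (did_trees_on R (2*n-1))) \<and>
            bond_char_poly G
              = (\<Sum>k=1..2*n-1. monom ((-1) ^ (k+1) * int (card (did_forests_k R (2*n-1) k))) (k-1))) \<and>
         (-1) ^ (card (bond_top G) + 1) * bond_moebius G (bond_bot G) (bond_top G)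
              = int (card (did_forests_k R (2*n-1) (card (bond_top G)))) \<and>
         monom 1 (card (bond_top G) - 1) * bond_char_poly G
              = (\<Sum>k=1..2*n-1. monom ((-1) ^ (k+1) * int (card (did_forests_k R (2*n-1) k))) (k-1))"
proof -
  let ?N = "2*n-1"
  let ?f = "\<lambda>\<pi>. {F \<in> did_forests_on R ?N. components F = \<pi>}"
  let ?\<mu> = "bond_moebius G (bond_bot G)"
  have s: "simple_graph G" using simple_graph_Gamma assms by simp
  have V: "verts G = {1..?N}" using assms by (simp add: verts_Gamma)
  have top: "bond_top G = components G" using bond_top_eq[OF s] .
  have mu: "(-1) ^ (card \<pi> + 1) * ?\<mu> \<pi> = int (card (?f \<pi>))" if "\<pi> \<in> bond_lattice G" for \<pi>
    using bond_moebius_Gamma[of n m \<pi>] that assms by simp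
  have mu': "?\<mu> \<pi> = (-1) ^ (card \<pi> + 1) * int (card (?f \<pi>))" if "\<pi> \<in> bond_lattice G" for \<pi>
    unfolding mu[OF that, symmetric] mult.assoc[symmetric] power_add[symmetric] by simp
  have forestE: "\<exists>E. F = (verts G, E) \<and> E \<subseteq> edges G" if "F \<in> did_forests_on R ?N" for F
    using that did_forests_on_eq[of m n] assms V by auto
  have "finite (edges G)"
    using s finite_subset[of "edges G" "Pow (verts G)"] by (auto simp: simple_graph_def)
  then have fin: "finite (did_forests_on R ?N)"
    using did_forests_on_eq[of m n] assms by (auto intro: finite_subset[of _ "Pow (edges G)"])
  have lattice: "components F \<in> bond_lattice G" if "F \<in> did_forests_on R ?N" for F
    using forestE[OF that] components_in_bond_lattice[OF s] by blast
  have finP: "finite (bond_lattice G)" using finite_bond_lattice[of G] V by simp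

  \<comment> \<open>The components of a forest refine those of the graph, and with equally many
    blocks they coincide.\<close>
  have "?f (components G) = did_forests_k R ?N (card (components G))"
  proof -
    have "components F = components G"
      if F: "F \<in> did_forests_on R ?N" "card (components F) = card (components G)" for F
    proof -
      have "refines (verts G) (components F) (components G)"
        using bond_orderD(3)[OF le_components[OF s lattice[OF F(1)]]] .
      moreover have "finite (components F)"
        using F(1) by (intro finite_components) (simp add: did_forests_on_def)
      ultimately show ?thesis using card_refines_le(2) F(2) by blast
    qed
    then show ?thesis by (auto simp: did_forests_k_def)
  qed
  then have 3: "(-1) ^ (card (bond_top G) + 1) * ?\<mu> (bond_top G) = int (card (did_forests_k R ?N (card (bond_top G))))"
    using mu[OF components_in_bond_lattice_self[OF s]] by (simp add: top)

  have forests_k: "card (did_forests_k R ?N k) = (\<Sum>\<pi> | \<pi> \<in> bond_lattice G \<and> card \<pi> = k. card (?f \<pi>))" for k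
  proof -
    have "(\<Sum>\<pi> | \<pi> \<in> bond_lattice G \<and> card \<pi> = k. card (?f \<pi>)) =
        (\<Sum>\<pi> | \<pi> \<in> bond_lattice G \<and> card \<pi> = k. \<Sum>F | F \<in> did_forests_k R ?N k \<and> components F = \<pi>. 1)"
      by (intro sum.cong refl) (auto simp: did_forests_k_def intro: arg_cong[of _ _ card])
    also have "\<dots> = (\<Sum>F\<in>did_forests_k R ?N k. 1)"
      using fin finP lattice by (intro sum.group) (auto simp: did_forests_k_def)
    finally show ?thesis by simp
  qed
  have "monom 1 (card (components G) - 1) * bond_char_poly G =
      (\<Sum>\<pi>\<in>bond_lattice G. monom (?\<mu> \<pi>) (card \<pi> - 1))"
    using monom_times_bond_char_poly[OF s] V assms(1) by simp
  \<comment> \<open>Regroup by the number of blocks, which is at least 1 because the vertex set is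
    nonempty.\<close>
  also have "\<dots> = (\<Sum>k=1..?N. \<Sum>\<pi> | \<pi> \<in> bond_lattice G \<and> card \<pi> = k. monom (?\<mu> \<pi>) (card \<pi> - 1))"
  proof (rule sum.group[symmetric])
    show "card ` bond_lattice G \<subseteq> {1..?N}"
    proof
      fix k assume "k \<in> card ` bond_lattice G"
      then obtain \<pi> where \<pi>: "\<pi> \<in> bond_lattice G" "k = card \<pi>" by blast
      have "components G \<noteq> {}" using V assms(1) by (simp add: components_def)
      then have "1 \<le> card (components G)"
        using finite_components[of G] V by (simp add: Suc_le_eq card_gt_0_iff)
      then show "k \<in> {1..?N}"
        using card_top_le[OF s \<pi>(1)] card_bond_lattice_le[OF s \<pi>(1)] \<pi>(2) V by simp
    qed
  qed (use finP in auto)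
  also have "\<dots> = (\<Sum>k=1..?N. monom ((-1) ^ (k+1) * int (card (did_forests_k R ?N k))) (k-1))"
  proof (rule sum.cong[OF refl])
    fix k
    have "(\<Sum>\<pi> | \<pi> \<in> bond_lattice G \<and> card \<pi> = k. monom (?\<mu> \<pi>) (card \<pi> - 1)) =
        (\<Sum>\<pi> | \<pi> \<in> bond_lattice G \<and> card \<pi> = k. monom ((-1) ^ (k+1) * int (card (?f \<pi>))) (k - 1))"
      by (intro sum.cong refl) (use mu' in auto)
    also have "\<dots> = monom ((-1) ^ (k+1) * int (card (did_forests_k R ?N k))) (k-1)"
      unfolding forests_k of_nat_sum sum_distrib_left by (rule poly_eqI) (simp add: coeff_sum)
    finally show "(\<Sum>\<pi> | \<pi> \<in> bond_lattice G \<and> card \<pi> = k. monom (?\<mu> \<pi>) (card \<pi> - 1)) =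
        monom ((-1) ^ (k+1) * int (card (did_forests_k R ?N k))) (k-1)" .
  qed
  finally have 4: "monom 1 (card (bond_top G) - 1) * bond_char_poly G =
      (\<Sum>k=1..?N. monom ((-1) ^ (k+1) * int (card (did_forests_k R ?N k))) (k-1))"
    by (simp only: top)

  have 2: "?\<mu> (bond_top G) = int (card (did_trees_on R ?N)) \<and>
      bond_char_poly G = (\<Sum>k=1..?N. monom ((-1) ^ (k+1) * int (card (did_forests_k R ?N k))) (k-1))"
    if "m = ?N"
  proof -
    have c: "components G = {{1..?N}}" using components_Gamma_full[OF assms(1)] assms(6) that by simp
    have "?\<mu> (bond_top G) = int (card (did_trees_on R ?N))"
      using mu[OF components_in_bond_lattice_self[OF s]] by (simp add: top c did_trees_on_eq)
    moreover have "monom 1 (card (bond_top G) - 1) = (1 :: int poly)" by (simp add: top c)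
    ultimately show ?thesis using 4 by simp
  qed
  show ?thesis using mu 2 3 4 by blast
qed

end
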